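(* Let $d\ge 2$ be an integer. There exists a probability distribution $\pi$ on $\{0,1,2,\ldots\}$ with infinite mean such that the frog model on the $(d+1)$-regular tree $\mathbf{T}_d$, started from the root $\rho$ with i.i.d.-$\pi$ initial conditions, is almost surely transient.
   Context: $\mathbf{T}_d$ denotes the infinite $(d+1)$-regular tree, with a designated vertex $\rho$ called the root. Frog model with i.i.d.-$\pi$ initial conditions on $\mathbf{T}_d$: initially $\rho$ contains one active particle, and every other vertex $v$ contains $\eta(v)$ sleeping particles, where the $\eta(v)$ are i.i.d. with distribution $\pi$. Active particles perform independent simple random walks on $\mathbf{T}_d$ in discrete time (independent also of $\eta$); sleeping particles do not move. When an active particle visits a vertex, all sleeping particles there become active, and they then perform their own independent simple random walks from that vertex. Particles never fall back asleep. A realization of the frog model is called recurrent if the starting vertex $\rho$ is visited infinitely often by particles (counting the visits of all particles over all time), and transient otherwise. *)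

theory Defs
  imports "HOL-Probability.Probability"
begin

text \<open>
  The tree \<open>\<^bold>T\<^sub>d\<close> is realised as the set of words over the alphabet \<open>{0..d}\<close> without two equal
  consecutive letters, rooted at the empty word. A non-empty word has its tail as parent. The lemmas
  following the definition show that this is a connected, acyclic, \<open>(d+1)\<close>-regular graph.
\<close>

type_synonym vertex = "nat list"

abbreviation root :: vertex ("\<rho>") where
  "\<rho> \<equiv> []"

definition tree_vertices :: "nat \<Rightarrow> vertex set" where
  "tree_vertices d = {x. set x \<subseteq> {0..d} \<and> distinct_adj x}"

definition tree_adj :: "nat \<Rightarrow> vertex \<Rightarrow> vertex \<Rightarrow> bool" where
  "tree_adj d x y \<longleftrightarrow>
     x \<in> tree_vertices d \<and> y \<in> tree_vertices d \<and> (\<exists>a. x = a # y \<or> y = a # x)"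

text \<open>
  \<open>step x a\<close> is the neighbour of \<open>x\<close> along the edge labelled \<open>a\<close>: edges are labelled so that at
  every vertex the \<open>d + 1\<close> incident edges carry the labels \<open>0, \<dots>, d\<close>, the edge to the parent of
  \<open>a # x\<close> being labelled \<open>a\<close>.
\<close>

definition step :: "vertex \<Rightarrow> nat \<Rightarrow> vertex" where
  "step x a = (if x \<noteq> [] \<and> hd x = a then tl x else a # x)"

lemma bij_betw_step:
  assumes "x \<in> tree_vertices d"
  shows "bij_betw (step x) {0..d} {y. tree_adj d x y}"
proof (rule bij_betw_imageI)
  show "inj_on (step x) {0..d}"
    by (cases x) (auto simp: inj_on_def step_def split: if_splits dest: arg_cong[of _ _ length])
  show "step x ` {0..d} = {y. tree_adj d x y}"
  proof (intro equalityI subsetI)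
    fix y assume "y \<in> step x ` {0..d}"
    then show "y \<in> {y. tree_adj d x y}"
      using assms
      by (cases x)
        (auto simp: step_def tree_adj_def tree_vertices_def distinct_adj_Cons split: if_splits)
  next
    fix y assume "y \<in> {y. tree_adj d x y}"
    then obtain a where y: "y \<in> tree_vertices d" "x = a # y \<or> y = a # x"
      by (auto simp: tree_adj_def)
    then have "a \<in> {0..d}" "y = step x a"
      using assms by (auto simp: step_def tree_vertices_def distinct_adj_Cons)
    then show "y \<in> step x ` {0..d}" by blast
  qed
qed

lemma card_neighbours:
  "x \<in> tree_vertices d \<Longrightarrow> card {y. tree_adj d x y} = d + 1"
  using bij_betw_same_card[OF bij_betw_step] by fastforce

lemma map_pmf_step:
  assumes "x \<in> tree_vertices d"
  shows "map_pmf (step x) (pmf_of_set {0..d}) = pmf_of_set {y. tree_adj d x y}"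
  using map_pmf_of_set_inj[of "step x" "{0..d}"] bij_betw_step[OF assms]
  by (auto simp: bij_betw_def)

lemma tree_connected:
  "x \<in> tree_vertices d \<Longrightarrow> (tree_adj d)\<^sup>*\<^sup>* \<rho> x"
proof (induction x)
  case (Cons a x)
  then have "x \<in> tree_vertices d" "tree_adj d x (a # x)"
    by (auto simp: tree_adj_def tree_vertices_def distinct_adj_Cons)
  with Cons.IH show ?case by (meson rtranclp.rtrancl_into_rtrancl)
qed simp

lemma tree_acyclic:
  assumes "length vs \<ge> 3" "distinct vs"
  shows "\<not> (\<forall>i<length vs. tree_adj d (vs ! i) (vs ! (Suc i mod length vs)))"
proof
  let ?n = "length vs"
  assume adj: "\<forall>i<?n. tree_adj d (vs ! i) (vs ! (Suc i mod ?n))"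
  obtain i where i: "i < ?n" "\<And>j. j < ?n \<Longrightarrow> length (vs ! j) \<le> length (vs ! i)"
  proof -
    let ?f = "\<lambda>i. length (vs ! i)"
    have "{..<?n} \<noteq> {}" using assms(1) by (cases vs) auto
    then have "Max (?f ` {..<?n}) \<in> ?f ` {..<?n}" by (intro Max_in) auto
    then obtain i where "i < ?n" "?f i = Max (?f ` {..<?n})" by auto
    moreover have "?f j \<le> Max (?f ` {..<?n})" if "j < ?n" for j
      using that by (intro Max_ge) auto
    ultimately show ?thesis using that by metis
  qed
  define j where "j = Suc i mod ?n"
  define k where "k = (if i = 0 then ?n - 1 else i - 1)"
  have jk: "j < ?n" "k < ?n" "Suc k mod ?n = i" "j \<noteq> k"
    using i(1) assms(1) by (auto simp: j_def k_def mod_Suc)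
  have "tree_adj d (vs ! i) (vs ! j)" "tree_adj d (vs ! k) (vs ! i)"
    using adj i(1) jk by (auto simp: j_def)
  then have "vs ! j = tl (vs ! i)" "vs ! k = tl (vs ! i)"
    using i(2)[OF jk(1)] i(2)[OF jk(2)] by (auto simp: tree_adj_def)
  with jk assms(2) show False by (metis nth_eq_iff_index_eq)
qed

text \<open>
  A particle is identified by the vertex \<open>v\<close> where it starts and an index \<open>i\<close>; the environment
  \<open>\<eta>\<close> decides which indices are in use. Attached to the particle \<open>(v, i)\<close> is the sequence of edge
  labels \<open>\<xi> (v, i, 0), \<xi> (v, i, 1), \<dots>\<close>. When these are independent and uniform on \<open>{0..d}\<close>, every
  move is to a uniformly chosen neighbour by \<open>map_pmf_step\<close>, so that \<open>walk \<xi> v i\<close> is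
  a simple random walk from \<open>v\<close>, run on the particle's own clock, which starts when it is woken up.
\<close>

primrec walk :: "(vertex \<times> nat \<times> nat \<Rightarrow> nat) \<Rightarrow> vertex \<Rightarrow> nat \<Rightarrow> nat \<Rightarrow> vertex" where
  "walk \<xi> v i 0 = v"
| "walk \<xi> v i (Suc t) = step (walk \<xi> v i t) (\<xi> (v, i, t))"

definition initial_particles :: "(vertex \<Rightarrow> nat) \<Rightarrow> vertex \<Rightarrow> nat" where
  "initial_particles \<eta> v = (if v = \<rho> then 1 else \<eta> v)"

type_synonym realization = "(vertex \<Rightarrow> nat) \<times> (vertex \<times> nat \<times> nat \<Rightarrow> nat)"

text \<open>
  \<open>wake \<omega> n v = Some s\<close> means that \<open>v\<close> is first visited at time \<open>s \<le> n\<close>, which is when the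
  particles starting there become active; \<open>None\<close> means that \<open>v\<close> is not visited up to time \<open>n\<close>.
\<close>

primrec wake :: "realization \<Rightarrow> nat \<Rightarrow> vertex \<Rightarrow> nat option" where
  "wake \<omega> 0 = [\<rho> \<mapsto> 0]"
| "wake \<omega> (Suc n) = (\<lambda>v.
     case wake \<omega> n v of
       Some s \<Rightarrow> Some s
     | None \<Rightarrow>
         if \<exists>u i s. wake \<omega> n u = Some s \<and> i < initial_particles (fst \<omega>) u
                  \<and> walk (snd \<omega>) u i (Suc n - s) = v
         then Some (Suc n) else None)"

definition active_at :: "realization \<Rightarrow> vertex \<Rightarrow> nat \<Rightarrow> nat \<Rightarrow> vertex \<Rightarrow> bool" where
  "active_at \<omega> u i n v \<longleftrightarrow>
     (\<exists>s. wake \<omega> n u = Some s \<and> i < initial_particles (fst \<omega>) u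
          \<and> walk (snd \<omega>) u i (n - s) = v)"

definition root_visits :: "realization \<Rightarrow> (vertex \<times> nat \<times> nat) set" where
  "root_visits \<omega> = {(u, i, n). active_at \<omega> u i n \<rho>}"

definition recurrent :: "realization \<Rightarrow> bool" where
  "recurrent \<omega> \<longleftrightarrow> infinite (root_visits \<omega>)"

definition transient :: "realization \<Rightarrow> bool" where
  "transient \<omega> \<longleftrightarrow> \<not> recurrent \<omega>"

definition frog_model :: "nat \<Rightarrow> nat pmf \<Rightarrow> realization measure" where
  "frog_model d \<pi> =
     (\<Pi>\<^sub>M v\<in>tree_vertices d. measure_pmf \<pi>) \<Otimes>\<^sub>M
     (\<Pi>\<^sub>M p\<in>tree_vertices d \<times> UNIV \<times> UNIV. measure_pmf (pmf_of_set {0..d}))"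

lemma prob_space_frog_model: "prob_space (frog_model d \<pi>)"
proof -
  interpret A: product_prob_space "\<lambda>_. measure_pmf \<pi>" "tree_vertices d"
    by unfold_locales
  interpret B: product_prob_space "\<lambda>_. measure_pmf (pmf_of_set {0..d})"
      "tree_vertices d \<times> (UNIV :: nat set) \<times> (UNIV :: nat set)"
    by unfold_locales
  interpret pair_prob_space "\<Pi>\<^sub>M v\<in>tree_vertices d. measure_pmf \<pi>"
      "\<Pi>\<^sub>M p\<in>tree_vertices d \<times> (UNIV :: nat set) \<times> (UNIV :: nat set).
        measure_pmf (pmf_of_set {0..d})"
    by unfold_locales
  show ?thesis unfolding frog_model_def by (rule prob_space_axioms)
qed

end

theory Submission imports Defs begin

text \<open>
  The infinite mean is compatible with transience because a cluster of \<open>n\<close> particles is far from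
  waking \<open>n\<close> times as much as one particle does: near the cluster the walks mostly visit the same
  vertices. A single walk from \<open>u\<close> reaches \<open>v\<close> with probability at most \<open>d\<close> to the power
  \<open>-dist u v\<close>, hence some walk of a cluster of \<open>n\<close> does so with probability at most
  \<open>min 1 x \<le> x powr (3/4)\<close>, where \<open>x\<close> is \<open>n\<close> times this bound. Averaging over \<open>n\<close>, the vertex \<open>u\<close>
  wakes \<open>v\<close> directly with probability at most \<open>\<epsilon> * s ^ dist u v\<close>, where \<open>s = d powr (-3/4)\<close> and \<open>\<epsilon>\<close> is
  the moment of order \<open>3/4\<close> of \<open>\<pi>\<close>. There are laws with infinite mean for which this moment is as
  small as one likes (\<open>ex_heavy_tailed_pmf\<close>): mix the law of \<open>2 ^ J\<close>, with \<open>J\<close> geometric of parameter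
  \<open>1/2\<close>, with a large mass at \<open>0\<close>.

  The kernel \<open>s ^ dist u v\<close> is bounded on the weight \<open>d powr (-1/2)\<close> to the power of the distance from
  the root (\<open>sum_tree_dist_le\<close>): a path from \<open>u\<close> to \<open>v\<close> climbs some number of edges towards the root
  and then descends, a climb by one edge contributes a factor \<open>d powr (1/2) * s\<close>, a descent by one edge
  a factor \<open>d * d powr (-1/2) * s\<close>, and both equal \<open>d powr (-1/4) < 1\<close>. Thus for small \<open>\<epsilon>\<close> the wake-up
  process is dominated by a subcritical one.

  This is made precise without conditioning on the dynamics. If \<open>u\<close> wakes up and one of its particles
  comes to the root, there is a chain of distinct vertices from the root to \<open>u\<close> in which each vertex
  has a particle whose walk visits the next one, and \<open>u\<close> has one that visits the root. For
  a given chain these events concern distinct vertices, so that they are independent and the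
  probability is at most a product of kernels (\<open>emeasure_links_le\<close>). By the weight, the sum over all
  chains is finite (\<open>sum_chain_weight_le\<close>), and Borel-Cantelli leaves finitely many chains, hence
  finitely many vertices whose particles ever come to the root (\<open>AE_finite_open_chains\<close>). As each single
  walk on the tree is transient (\<open>AE_finite_root_visits\<close>), there are finitely many visits in total.
\<close>

section \<open>Distances in the tree\<close>

text \<open>
  The tree is the Cayley graph of the free product of \<open>d + 1\<close> groups of order two: words are reduced
  group elements, \<open>step\<close> is multiplication by a generator on the left, and reversal is inversion. In
  this group \<open>mul u w\<close> is the product. Right multiplication by \<open>rev v\<close> is an automorphism of the tree
  that takes \<open>v\<close> to the root, which reduces hitting \<open>v\<close> to hitting the root.
\<close>

definition mul :: "vertex \<Rightarrow> vertex \<Rightarrow> vertex" where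
  "mul u w = foldr (\<lambda>a y. step y a) u w"

lemma distinct_adj_step: "distinct_adj x \<Longrightarrow> distinct_adj (step x a)"
  by (cases x) (auto simp: step_def distinct_adj_Cons)

lemma step_step: "distinct_adj x \<Longrightarrow> step (step x a) a = x"
  by (cases x) (auto simp: step_def distinct_adj_Cons)

lemma distinct_adj_mul: "distinct_adj w \<Longrightarrow> distinct_adj (mul u w)"
  by (induction u) (auto simp: mul_def distinct_adj_step)

lemma mul_step:
  assumes "distinct_adj w"
  shows "mul (step x a) w = step (mul x w) a"
proof (cases "x \<noteq> [] \<and> hd x = a")
  case True
  then obtain y where "x = a # y" by (cases x) auto
  then show ?thesis
    using step_step[OF distinct_adj_mul[OF assms, of y], of a] by (simp add: step_def mul_def)
next
  case False
  then have "step x a = a # x" by (auto simp: step_def)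
  then show ?thesis by (simp add: mul_def)
qed

lemma mul_append: "mul (p @ z) w = mul p (mul z w)"
  by (simp add: mul_def)

lemma mul_rev_append: "mul z (rev z @ w) = w"
proof (induction z arbitrary: w)
  case (Cons a z)
  show ?case using Cons[of "a # w"] by (simp add: mul_def step_def)
qed (simp add: mul_def)

lemma mul_eq_append: "distinct_adj (p @ w) \<Longrightarrow> mul p w = p @ w"
proof (induction p)
  case (Cons a p)
  then show ?case by (cases "p @ w") (auto simp: mul_def step_def distinct_adj_Cons)
qed (simp add: mul_def)

text \<open>
  The length of \<open>u\<close> multiplied by the inverse of \<open>v\<close> is the graph distance from \<open>u\<close> to \<open>v\<close>.
\<close>
definition tree_dist :: "vertex \<Rightarrow> vertex \<Rightarrow> nat" where
  "tree_dist u v = length (mul u (rev v))"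

text \<open>
  The path from \<open>u\<close> to \<open>v\<close> climbs \<open>i\<close> edges to the last common ancestor, which is the longest common
  suffix, and then descends along \<open>q\<close>.
\<close>
lemma tree_dist_split:
  assumes "distinct_adj u" "distinct_adj v"
  obtains i q where "i \<le> length u" "v = q @ drop i u" "tree_dist u v = i + length q"
proof -
  obtain p q z where *: "u = p @ z" "v = q @ z" "p = [] \<or> q = [] \<or> last p \<noteq> last q"
    using longest_common_suffix[of u v] by metis
  have "distinct_adj (p @ rev q)"
    using assms * by (auto simp: distinct_adj_append_iff hd_rev)
  then have "tree_dist u v = length p + length q"
    using * by (simp add: tree_dist_def mul_append mul_rev_append mul_eq_append)
  with * show ?thesis by (intro that[of "length p" q]) auto
qed

lemma card_tree_sphere:
  assumes "d \<ge> 1"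
  shows "finite {q \<in> tree_vertices d. length q = j} \<and>
    card {q \<in> tree_vertices d. length q = j} \<le> 2 * d ^ j"
proof (induction j)
  case 0
  have "{q \<in> tree_vertices d. length q = 0} = {[]}" by (auto simp: tree_vertices_def)
  then show ?case by simp
next
  case (Suc j)
  let ?S = "\<lambda>j. {q \<in> tree_vertices d. length q = j}"
  let ?B = "\<lambda>q. (\<lambda>a. a # q) ` {a \<in> {0..d}. q \<noteq> [] \<longrightarrow> a \<noteq> hd q}"
  have eq: "?S (Suc j) \<subseteq> (\<Union>q\<in>?S j. ?B q)"
  proof
    fix x assume "x \<in> ?S (Suc j)"
    then show "x \<in> (\<Union>q\<in>?S j. ?B q)"
      by (cases x) (auto simp: tree_vertices_def distinct_adj_Cons)
  qed
  have fin: "finite (\<Union>q\<in>?S j. ?B q)" using Suc by auto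
  have "card (?S (Suc j)) \<le> card (\<Union>q\<in>?S j. ?B q)" using eq fin by (rule card_mono[rotated])
  also have "\<dots> \<le> (\<Sum>q\<in>?S j. card (?B q))" using Suc by (intro card_UN_le) auto
  also have "\<dots> \<le> 2 * d ^ Suc j"
  proof (cases "j = 0")
    case True
    have "?S 0 = {[]}" by (auto simp: tree_vertices_def)
    moreover have "card (?B []) = Suc d" by (subst card_image) (auto simp: inj_on_def atMost_def[symmetric])
    ultimately show ?thesis using True assms by simp
  next
    case False
    have "card (?B q) \<le> d" if "q \<in> ?S j" for q
    proof -
      have "q \<noteq> []" "hd q \<in> {0..d}"
        using that False by (cases q; auto simp: tree_vertices_def)+
      then have "{a \<in> {0..d}. q \<noteq> [] \<longrightarrow> a \<noteq> hd q} = {0..d} - {hd q}" by auto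
      then show ?thesis
        using \<open>hd q \<in> _\<close> card_image_le[of "{0..d} - {hd q}" "\<lambda>a. a # q"] by simp
    qed
    then have "(\<Sum>q\<in>?S j. card (?B q)) \<le> card (?S j) * d"
      using sum_bounded_above[of "?S j" "\<lambda>q. card (?B q)" d] by simp
    also have "\<dots> \<le> 2 * d ^ j * d" using Suc by simp
    finally show ?thesis by (simp add: mult.commute)
  qed
  finally show ?case using finite_subset[OF eq fin] by simp
qed

lemma sum_geometric_le:
  fixes x :: real assumes "0 \<le> x" "x < 1" shows "(\<Sum>i\<le>n. x ^ i) \<le> 1 / (1 - x)"
proof -
  have "(\<Sum>i\<le>n. x ^ i) \<le> (\<Sum>i. x ^ i)"
    using assms by (intro sum_le_suminf summable_geometric) auto
  then show ?thesis using suminf_geometric[of x] assms by simp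
qed

text \<open>
  The vertex \<open>v\<close> is determined by the number \<open>i\<close> of upward edges and the word \<open>q\<close> of downward edges on
  the path from \<open>u\<close>, and there are at most \<open>2 * d ^ j\<close> words of length \<open>j\<close>. The sum is therefore bounded
  by a product of two geometric series. With \<open>b = d powr (1/4)\<close> the exponents chosen for the kernel and
  for the weight give both of them the ratio \<open>1 / b\<close>.
\<close>
lemma sum_tree_dist_le:
  fixes b :: real
  assumes d: "d \<ge> 1" and b: "b > 1" "b ^ 4 = real d"
    and u: "u \<in> tree_vertices d" and V: "finite V" "V \<subseteq> tree_vertices d"
  shows "(\<Sum>v\<in>V. (1 / b ^ 3) ^ tree_dist u v * (1 / b\<^sup>2) ^ length v)
    \<le> 2 / (1 - 1 / b)\<^sup>2 * (1 / b\<^sup>2) ^ length u"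
proof -
  define s l c where "s = 1 / b ^ 3" and "l = 1 / b\<^sup>2" and "c = 1 / (1 - 1 / b)"
  have pos: "s > 0" "l > 0" "c > 0" using b by (auto simp: s_def l_def c_def)
  have "\<exists>i q. i \<le> length u \<and> v = q @ drop i u \<and> tree_dist u v = i + length q" if "v \<in> V" for v
  proof -
    have "distinct_adj u" "distinct_adj v" using u V that by (auto simp: tree_vertices_def)
    then show ?thesis by (metis tree_dist_split)
  qed
  then obtain i q where h: "\<And>v. v \<in> V \<Longrightarrow> i v \<le> length u"
      "\<And>v. v \<in> V \<Longrightarrow> v = q v @ drop (i v) u"
      "\<And>v. v \<in> V \<Longrightarrow> tree_dist u v = i v + length (q v)"
    by metis
  define N where "N = Max (insert 0 (length ` V))"
  define Q where "Q = {q \<in> tree_vertices d. length q \<le> N}"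
  define F where "F = (\<lambda>(i, q :: vertex). s ^ (i + length q) * l ^ (length q + (length u - i)) :: real)"
  have S: "finite {q \<in> tree_vertices d. length q = j}"
      "card {q \<in> tree_vertices d. length q = j} \<le> 2 * d ^ j" for j
    using card_tree_sphere[OF d] by blast+
  have Q: "Q = (\<Union>j\<le>N. {q \<in> tree_vertices d. length q = j})" by (auto simp: Q_def)
  then have finQ: "finite Q" using S by auto
  have qQ: "q v \<in> Q" if "v \<in> V" for v
  proof -
    have "length v \<le> N" using that V by (auto simp: N_def intro!: Max_ge)
    moreover have "length (q v) \<le> length v"
      using arg_cong[OF h(2)[OF that], of length] by simp
    moreover have "v \<in> tree_vertices d" using that V by auto
    then have "q v \<in> tree_vertices d"
      using h(2)[OF that]
      by (metis (no_types, lifting) distinct_adj_appendD1 le_sup_iff mem_Collect_eq set_append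
          tree_vertices_def)
    ultimately show ?thesis by (simp add: Q_def)
  qed
  have "(\<Sum>v\<in>V. s ^ tree_dist u v * l ^ length v) = (\<Sum>v\<in>V. F (i v, q v))"
  proof (rule sum.cong[OF refl])
    fix v assume v: "v \<in> V"
    have "length v = length (q v) + (length u - i v)"
      using arg_cong[OF h(2)[OF v], of length] by simp
    then show "s ^ tree_dist u v * l ^ length v = F (i v, q v)"
      using h(3)[OF v] by (simp add: F_def)
  qed
  also have "\<dots> = sum F ((\<lambda>v. (i v, q v)) ` V)"
    by (subst sum.reindex) (use h(2) in \<open>auto simp: inj_on_def, metis\<close>)
  also have "\<dots> \<le> sum F ({..length u} \<times> Q)"
    using finQ qQ h(1) pos by (intro sum_mono2) (auto simp: F_def)
  also have "\<dots> = (\<Sum>i\<le>length u. \<Sum>q\<in>Q. F (i, q))"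
    by (simp add: sum.cartesian_product)
  also have "\<dots> = (\<Sum>i\<le>length u. l ^ length u * (s / l) ^ i * (\<Sum>q\<in>Q. (s * l) ^ length q))"
  proof (rule sum.cong[OF refl])
    fix i assume "i \<in> {..length u}"
    then have "length u = i + (length u - i)" by simp
    then have "l ^ length u = l ^ i * l ^ (length u - i)" by (metis power_add)
    then show "(\<Sum>q\<in>Q. F (i, q)) = l ^ length u * (s / l) ^ i * (\<Sum>q\<in>Q. (s * l) ^ length q)"
      using pos by (simp add: F_def sum_distrib_left power_add power_divide power_mult_distrib
          field_simps)
  qed
  also have "\<dots> = l ^ length u * (\<Sum>i\<le>length u. (s / l) ^ i) * (\<Sum>q\<in>Q. (s * l) ^ length q)"
    by (simp flip: sum_distrib_left sum_distrib_right)
  also have "\<dots> \<le> l ^ length u * c * (2 * c)"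
  proof (intro mult_mono mult_left_mono)
    have "s / l = 1 / b" using b by (simp add: s_def l_def power2_eq_square power3_eq_cube)
    then show "(\<Sum>i\<le>length u. (s / l) ^ i) \<le> c"
      using sum_geometric_le[of "1 / b"] b by (simp add: c_def)
    have dsl: "real d * (s * l) = 1 / b"
      using b(1) unfolding b(2)[symmetric]
      by (simp add: s_def l_def field_simps flip: power_add) (simp add: numeral_eq_Suc)
    have "(\<Sum>q\<in>Q. (s * l) ^ length q) =
        (\<Sum>j\<le>N. \<Sum>q\<in>{q \<in> tree_vertices d. length q = j}. (s * l) ^ length q)"
      unfolding Q using S by (intro sum.UNION_disjoint) auto
    also have "\<dots> = (\<Sum>j\<le>N. real (card {q \<in> tree_vertices d. length q = j}) * (s * l) ^ j)"
      by (intro sum.cong) auto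
    also have "\<dots> \<le> (\<Sum>j\<le>N. real (2 * d ^ j) * (s * l) ^ j)"
      using S(2) pos by (intro sum_mono mult_right_mono) (auto simp del: of_nat_mult)
    also have "\<dots> = 2 * (\<Sum>j\<le>N. (1 / b) ^ j)"
      by (simp add: sum_distrib_left mult.assoc flip: power_mult_distrib dsl)
    also have "\<dots> \<le> 2 * c"
      unfolding c_def using b by (intro mult_left_mono sum_geometric_le) auto
    finally show "(\<Sum>q\<in>Q. (s * l) ^ length q) \<le> 2 * c" .
  qed (use pos in \<open>auto intro!: sum_nonneg mult_nonneg_nonneg\<close>)
  finally show ?thesis
    by (simp add: s_def l_def c_def power2_eq_square mult.commute)
qed

section \<open>Random iterations driven by independent inputs\<close>

text \<open>
  A Markov chain given as a random iteration \<open>S\<close>, whose step \<open>t\<close> consumes the coordinate \<open>p t\<close> of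
  a product measure. As the walks of all particles live on one product space, this form applies to
  each of them without passing to its marginal law.
\<close>
context
  fixes \<nu> :: "'a pmf" and I :: "'i set" and p :: "nat \<Rightarrow> 'i"
    and S :: "nat \<Rightarrow> ('i \<Rightarrow> 'a) \<Rightarrow> 's :: countable" and F :: "'s \<Rightarrow> 'a \<Rightarrow> 's" and init :: 's
  assumes inj: "inj p" and p: "\<And>t. p t \<in> I"
    and S0: "\<And>\<omega>. S 0 \<omega> = init" and S_Suc: "\<And>t \<omega>. S (Suc t) \<omega> = F (S t \<omega>) (\<omega> (p t))"
begin

lemma measurable_iterates: "S t \<in> (\<Pi>\<^sub>M i\<in>I. measure_pmf \<nu>) \<rightarrow>\<^sub>M count_space UNIV"
proof (induction t)
  case 0
  have "S 0 = (\<lambda>_. init)" using S0 by auto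
  then show ?case by simp
next
  case (Suc t)
  have "S (Suc t) = (\<lambda>\<omega>. F (S t \<omega>) (\<omega> (p t)))" using S_Suc by auto
  moreover have "(\<lambda>\<omega>. F s (\<omega> (p t))) \<in> (\<Pi>\<^sub>M i\<in>I. measure_pmf \<nu>) \<rightarrow>\<^sub>M count_space UNIV" for s
    by (rule measurable_compose[OF measurable_component_singleton[OF p]]) simp
  ultimately show ?case
    using measurable_compose_countable[of "\<lambda>s \<omega>. F s (\<omega> (p t))", OF _ Suc] by simp
qed

lemma iterates_fun_upd: "t \<le> t' \<Longrightarrow> S t (X(p t' := x)) = S t X"
proof (induction t)
  case (Suc t)
  moreover have "p t \<noteq> p t'" using Suc.prems injD[OF inj, of t t'] by auto
  ultimately show ?case by (simp add: S_Suc)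
qed (simp add: S0)

text \<open>
  If \<open>\<Phi>\<close> contracts by the factor \<open>r\<close> in mean under one step, then it does so along the iteration. The
  coordinate \<open>p t\<close> is integrated first: the state at time \<open>t\<close> does not depend on it, so that it can be
  resampled while that state stays fixed.
\<close>
lemma nn_integral_iterates_le:
  fixes \<Phi> :: "'s \<Rightarrow> ennreal"
  assumes \<Phi>: "\<And>s. (\<integral>\<^sup>+ a. \<Phi> (F s a) \<partial>measure_pmf \<nu>) \<le> r * \<Phi> s"
  shows "(\<integral>\<^sup>+ \<omega>. \<Phi> (S t \<omega>) \<partial>(\<Pi>\<^sub>M i\<in>I. measure_pmf \<nu>)) \<le> r ^ t * \<Phi> init"
proof (induction t)
  case 0
  interpret prob_space "\<Pi>\<^sub>M i\<in>I. measure_pmf \<nu>"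
    by (intro prob_space_PiM prob_space_measure_pmf)
  show ?case by (simp add: S0 emeasure_space_1)
next
  case (Suc t)
  let ?M = "\<lambda>I. \<Pi>\<^sub>M i\<in>I. measure_pmf \<nu>"
  define J where "J = I - {p t}"
  have I: "I = insert (p t) J" using p by (auto simp: J_def)
  interpret J: prob_space "?M J"
    by (intro prob_space_PiM prob_space_measure_pmf)
  interpret pair_sigma_finite "measure_pmf \<nu>" "?M J"
    by unfold_locales
  have [measurable]: "(\<lambda>(x, X). X(p t := x)) \<in> measure_pmf \<nu> \<Otimes>\<^sub>M ?M J \<rightarrow>\<^sub>M ?M I"
    unfolding I by measurable
  \<comment> \<open>Resampling the coordinate \<open>p t\<close> does not change the product measure.\<close>
  have split: "(\<integral>\<^sup>+ \<omega>. g \<omega> \<partial>?M I) = (\<integral>\<^sup>+ X. \<integral>\<^sup>+ x. g (X(p t := x)) \<partial>measure_pmf \<nu> \<partial>?M J)"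
    if [measurable]: "g \<in> borel_measurable (?M I)" for g :: "_ \<Rightarrow> ennreal"
  proof -
    have "(\<integral>\<^sup>+ \<omega>. g \<omega> \<partial>?M I)
        = (\<integral>\<^sup>+ \<omega>. g \<omega> \<partial>distr (measure_pmf \<nu> \<Otimes>\<^sub>M ?M J) (?M I) (\<lambda>(x, X). X(p t := x)))"
      unfolding I by (subst distr_pair_PiM_eq_PiM) (auto intro: prob_space_measure_pmf)
    also have "\<dots> = (\<integral>\<^sup>+ y. g ((\<lambda>(x, X). X(p t := x)) y) \<partial>(measure_pmf \<nu> \<Otimes>\<^sub>M ?M J))"
      by (rule nn_integral_distr) auto
    also have "\<dots> = (\<integral>\<^sup>+ X. \<integral>\<^sup>+ x. g (X(p t := x)) \<partial>measure_pmf \<nu> \<partial>?M J)"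
      by (subst nn_integral_snd[symmetric]) auto
    finally show ?thesis .
  qed
  have meas: "(\<lambda>\<omega>. \<Phi> (S t \<omega>)) \<in> borel_measurable (?M I)" for t
    by (rule measurable_compose[OF measurable_iterates]) simp
  have "(\<integral>\<^sup>+ \<omega>. \<Phi> (S (Suc t) \<omega>) \<partial>?M I)
      = (\<integral>\<^sup>+ X. \<integral>\<^sup>+ x. \<Phi> (F (S t X) x) \<partial>measure_pmf \<nu> \<partial>?M J)"
    by (subst split[OF meas]) (simp add: S_Suc iterates_fun_upd)
  also have "\<dots> \<le> (\<integral>\<^sup>+ X. \<integral>\<^sup>+ x. r * \<Phi> (S t (X(p t := x))) \<partial>measure_pmf \<nu> \<partial>?M J)"
  proof (rule nn_integral_mono)
    fix X
    have "(\<integral>\<^sup>+ x. r * \<Phi> (S t (X(p t := x))) \<partial>measure_pmf \<nu>) = r * \<Phi> (S t X)"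
      by (simp add: iterates_fun_upd measure_pmf.emeasure_space_1 del: space_measure_pmf)
    with \<Phi>[of "S t X"] show "(\<integral>\<^sup>+ x. \<Phi> (F (S t X) x) \<partial>measure_pmf \<nu>)
        \<le> (\<integral>\<^sup>+ x. r * \<Phi> (S t (X(p t := x))) \<partial>measure_pmf \<nu>)" by simp
  qed
  also have "\<dots> = (\<integral>\<^sup>+ \<omega>. r * \<Phi> (S t \<omega>) \<partial>?M I)"
    by (rule split[symmetric]) (use meas in auto)
  also have "\<dots> = r * (\<integral>\<^sup>+ \<omega>. \<Phi> (S t \<omega>) \<partial>?M I)"
    by (rule nn_integral_cmult[OF meas])
  also have "\<dots> \<le> r * (r ^ t * \<Phi> init)"
    by (intro mult_left_mono Suc) auto
  finally show ?case by (simp add: mult.assoc)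
qed

end

section \<open>A single random walk\<close>
definition moves :: "nat \<Rightarrow> (vertex \<times> nat \<times> nat \<Rightarrow> nat) measure" where
  "moves d = (\<Pi>\<^sub>M p\<in>tree_vertices d \<times> UNIV \<times> UNIV. measure_pmf (pmf_of_set {0..d}))"

lemma prob_space_moves: "prob_space (moves d)"
  unfolding moves_def by (intro prob_space_PiM prob_space_measure_pmf)

lemma measurable_walk:
  assumes "{u} \<times> UNIV \<times> UNIV \<subseteq> I"
  shows "(\<lambda>\<xi>. walk \<xi> u i t) \<in> (\<Pi>\<^sub>M p\<in>I. measure_pmf \<nu>) \<rightarrow>\<^sub>M count_space UNIV"
  by (rule measurable_iterates[where p = "\<lambda>t. (u, i, t)" and F = step and init = u])
    (use assms in \<open>auto simp: inj_def\<close>)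

lemma measurable_walk_moves [measurable]:
  "u \<in> tree_vertices d \<Longrightarrow> (\<lambda>\<xi>. walk \<xi> u i t) \<in> moves d \<rightarrow>\<^sub>M count_space UNIV"
  unfolding moves_def by (rule measurable_walk) auto

lemma nn_integral_uniform:
  assumes "\<And>a. f a \<ge> 0"
  shows "(\<integral>\<^sup>+ a. ennreal (f a) \<partial>measure_pmf (pmf_of_set {0..d}))
    = ennreal ((\<Sum>a\<in>{0..d}. f a) / (real d + 1))"
proof -
  have "(\<integral>\<^sup>+ a. ennreal (f a) \<partial>measure_pmf (pmf_of_set {0..d}))
      = ennreal (sum f {0..d}) / ennreal (real (card {0..d}))"
    using assms
    by (subst nn_integral_pmf_of_set) (auto simp: sum_ennreal ennreal_of_nat_eq_real_of_nat)
  also have "\<dots> = ennreal (sum f {0..d} / real (card {0..d}))"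
    using assms by (intro divide_ennreal sum_nonneg) auto
  finally show ?thesis by (simp add: add.commute)
qed

text \<open>
  One neighbour is the parent and at most \<open>d\<close> are children. A word whose first letter is not a label
  has children only, and then the bound holds because the powers of \<open>c\<close> decrease; covering this case
  spares an invariant for the walk.
\<close>
lemma sum_step_le:
  fixes c :: real
  assumes "0 < c" "c \<le> 1"
  shows "(\<Sum>a\<in>{0..d}. c ^ length (step (x # y) a)) \<le> c ^ length y + real d * c ^ (length y + 2)"
proof (cases "x \<in> {0..d}")
  case True
  then have "(\<Sum>a\<in>{0..d}. c ^ length (step (x # y) a))
      = c ^ length y + (\<Sum>a\<in>{0..d} - {x}. c ^ length (step (x # y) a))"
    by (subst sum.remove[of _ x]) (auto simp: step_def)
  also have "(\<Sum>a\<in>{0..d} - {x}. c ^ length (step (x # y) a))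
      = (\<Sum>a\<in>{0..d} - {x}. c ^ (length y + 2))"
    by (intro sum.cong) (auto simp: step_def)
  finally show ?thesis using True by simp
next
  case False
  then have "(\<Sum>a\<in>{0..d}. c ^ length (step (x # y) a)) = (\<Sum>a\<in>{0..d}. c ^ (length y + 2))"
    by (intro sum.cong) (auto simp: step_def)
  moreover have "c ^ (length y + 2) \<le> c ^ length y"
    using assms by (intro power_decreasing) auto
  ultimately show ?thesis by (simp add: algebra_simps)
qed

text \<open>
  The walk frozen at the root, where \<open>d\<close> to the power of minus the length is a supermartingale.
\<close>
primrec stopped :: "(nat \<Rightarrow> nat) \<Rightarrow> vertex \<Rightarrow> nat \<Rightarrow> vertex" where
  "stopped a x 0 = x"
| "stopped a x (Suc t) = (if stopped a x t = [] then [] else step (stopped a x t) (a t))"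

lemma stopped_eq:
  assumes "distinct_adj v"
  shows "stopped (\<lambda>t. \<xi> (u, i, t)) (mul u (rev v)) t \<in> {[], mul (walk \<xi> u i t) (rev v)}"
  using assms by (induction t) (auto simp: mul_step)

text \<open>
  After translation of \<open>v\<close> to the root, the function \<open>(1 / d) ^ length x\<close> is harmonic off the root,
  since \<open>d + d * (1 / d) = d + 1\<close>, and equals \<open>1\<close> at the root. Its mean along the frozen walk bounds the
  probability of having reached the root by time \<open>t\<close>, uniformly in \<open>t\<close>.
\<close>
lemma emeasure_hit_le:
  assumes d: "d \<ge> 1" and u: "u \<in> tree_vertices d" and v: "v \<in> tree_vertices d"
  shows "emeasure (moves d) {\<xi> \<in> space (moves d). \<exists>t. walk \<xi> u i t = v}
    \<le> ennreal ((1 / real d) ^ tree_dist u v)"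
proof -
  let ?x = "mul u (rev v)"
  let ?S = "\<lambda>t \<xi>. stopped (\<lambda>t. \<xi> (u, i, t)) ?x t"
  let ?F = "\<lambda>x a. if x = [] then [] else step x a"
  let ?\<Phi> = "\<lambda>x :: vertex. ennreal ((1 / real d) ^ length x)"
  let ?A = "\<lambda>t. {\<xi> \<in> space (moves d). ?S t \<xi> = []}"
  note S = inj_def stopped.simps
  have meas: "?S t \<in> moves d \<rightarrow>\<^sub>M count_space UNIV" for t
    unfolding moves_def
    by (rule measurable_iterates[where p = "\<lambda>t. (u, i, t)" and F = ?F and init = ?x])
      (use u in \<open>auto simp: S\<close>)
  have avg: "(\<integral>\<^sup>+ a. ?\<Phi> (?F x a) \<partial>measure_pmf (pmf_of_set {0..d})) \<le> 1 * ?\<Phi> x" for x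
  proof (cases x)
    case Nil
    then show ?thesis
      by (simp add: measure_pmf.emeasure_space_1 del: space_measure_pmf)
  next
    case (Cons y ys)
    have "(\<Sum>a\<in>{0..d}. (1 / real d) ^ length (step x a))
        \<le> (1 / real d) ^ length ys + real d * (1 / real d) ^ (length ys + 2)"
      unfolding Cons using d by (intro sum_step_le) auto
    also have "\<dots> = (1 / real d) ^ length x * (real d + 1)"
      using d Cons by (simp add: field_simps)
    finally have "(\<Sum>a\<in>{0..d}. (1 / real d) ^ length (step x a)) / (real d + 1)
        \<le> (1 / real d) ^ length x"
      by (simp add: divide_le_eq)
    then show ?thesis
      using Cons by (simp add: nn_integral_uniform ennreal_leI)
  qed
  have A: "?A t \<in> sets (moves d)" for t
    using measurable_sets[OF meas[of t], of "{[]}"] by (simp add: vimage_def Int_def conj_commute)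
  have stop: "emeasure (moves d) (?A t) \<le> ?\<Phi> ?x" for t
  proof -
    have "emeasure (moves d) (?A t) = (\<integral>\<^sup>+ \<xi>. indicator (?A t) \<xi> \<partial>moves d)"
      using A by simp
    also have "\<dots> \<le> (\<integral>\<^sup>+ \<xi>. ?\<Phi> (?S t \<xi>) \<partial>moves d)"
      by (intro nn_integral_mono) (auto simp: indicator_def)
    also have "\<dots> \<le> 1 ^ t * ?\<Phi> ?x"
      unfolding moves_def
      by (rule nn_integral_iterates_le[where p = "\<lambda>t. (u, i, t)" and F = ?F, OF _ _ _ _ avg])
        (use u in \<open>auto simp: S\<close>)
    finally show ?thesis by simp
  qed
  have "\<xi> \<in> (\<Union>t. ?A t)" if "\<xi> \<in> space (moves d)" "walk \<xi> u i t = v" for \<xi> t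
    using that v stopped_eq[of v \<xi> u i t] mul_rev_append[of v "[]"]
    by (auto simp: tree_vertices_def)
  then have "{\<xi> \<in> space (moves d). \<exists>t. walk \<xi> u i t = v} \<subseteq> (\<Union>t. ?A t)" by blast
  then have "emeasure (moves d) {\<xi> \<in> space (moves d). \<exists>t. walk \<xi> u i t = v}
      \<le> emeasure (moves d) (\<Union>t. ?A t)"
    by (rule emeasure_mono) (use A in auto)
  also have "\<dots> = (SUP t. emeasure (moves d) (?A t))"
    by (intro SUP_emeasure_incseq[symmetric] incseq_SucI) (use A in auto)
  also have "\<dots> \<le> ?\<Phi> ?x" using stop by (rule SUP_least)
  finally show ?thesis by (simp add: tree_dist_def)
qed

text \<open>
  The mean of \<open>c ^ length x\<close> with \<open>c = 1 / sqrt d\<close> contracts in each step at least by the spectral radius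
  \<open>r = 2 * sqrt d / (d + 1)\<close>, so that the probability of being at the root at time \<open>t\<close> is at most
  \<open>r ^ t\<close>. As \<open>r < 1\<close>, Borel-Cantelli applies.
\<close>
lemma AE_finite_root_visits:
  assumes d: "d \<ge> 2"
  shows "AE \<xi> in moves d. \<forall>u\<in>tree_vertices d. \<forall>i. finite {t. walk \<xi> u i t = \<rho>}"
proof -
  interpret prob_space "moves d" by (rule prob_space_moves)
  define c r where "c = 1 / sqrt (real d)" and "r = 2 * sqrt (real d) / (real d + 1)"
  let ?\<Phi> = "\<lambda>x :: vertex. ennreal (c ^ length x)"
  have c: "0 < c" "c \<le> 1" "real d * c\<^sup>2 = 1" using d by (auto simp: c_def power_divide)
  have "(sqrt (real d) - 1)\<^sup>2 > 0" using d by simp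
  then have "2 * sqrt (real d) < real d + 1" using d by (simp add: power2_diff)
  then have r: "0 \<le> r" "r < 1" by (auto simp: r_def)
  have r_c: "r * (real d + 1) * c = 2"
    using d by (simp add: r_def c_def)
  have avg: "(\<integral>\<^sup>+ a. ?\<Phi> (step x a) \<partial>measure_pmf (pmf_of_set {0..d})) \<le> ennreal r * ?\<Phi> x" for x
  proof -
    have "(\<Sum>a\<in>{0..d}. c ^ length (step x a)) \<le> r * (real d + 1) * c ^ length x"
    proof (cases x)
      case Nil
      have "(\<Sum>a\<in>{0..d}. c ^ length (step x a)) = (real d + 1) * c"
        using Nil by (simp add: step_def algebra_simps)
      also have "\<dots> \<le> 2 * real d * c" using d c by (intro mult_right_mono) auto
      also have "\<dots> = 2 * (real d / sqrt (real d))" by (simp add: c_def)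
      also have "\<dots> = r * (real d + 1)" by (simp add: real_div_sqrt r_def)
      finally show ?thesis using Nil by simp
    next
      case (Cons y ys)
      have "(\<Sum>a\<in>{0..d}. c ^ length (step x a)) \<le> c ^ length ys + real d * c ^ (length ys + 2)"
        unfolding Cons using c by (intro sum_step_le) auto
      also have "\<dots> = c ^ length ys * (1 + real d * c\<^sup>2)"
        by (simp add: algebra_simps power_add power2_eq_square)
      also have "\<dots> = r * (real d + 1) * c ^ length x"
        unfolding c(3) Cons using arg_cong[OF r_c, of "\<lambda>y. y * c ^ length ys"] by (simp add: mult_ac)
      finally show ?thesis .
    qed
    then show ?thesis
      using c r by (simp add: nn_integral_uniform divide_le_eq algebra_simps flip: ennreal_mult)
  qed
  have ret: "AE \<xi> in moves d. finite {t. walk \<xi> u i t = \<rho>}" if u: "u \<in> tree_vertices d" for u i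
  proof -
    let ?A = "\<lambda>t. {\<xi> \<in> space (moves d). walk \<xi> u i t = \<rho>}"
    have meas: "?A t \<in> sets (moves d)" for t
      using measurable_sets[OF measurable_walk_moves[OF u], of "{[]}"]
      by (simp add: vimage_def Int_def conj_commute)
    have le: "prob (?A t) \<le> r ^ t" for t
    proof -
      have "emeasure (moves d) (?A t) = (\<integral>\<^sup>+ \<xi>. indicator (?A t) \<xi> \<partial>moves d)"
        using meas by simp
      also have "\<dots> \<le> (\<integral>\<^sup>+ \<xi>. ?\<Phi> (walk \<xi> u i t) \<partial>moves d)"
        by (intro nn_integral_mono) (auto simp: indicator_def)
      also have "\<dots> \<le> ennreal r ^ t * ?\<Phi> u"
        unfolding moves_def
        by (rule nn_integral_iterates_le[where p = "\<lambda>t. (u, i, t)" and F = step, OF _ _ _ _ avg])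
          (use u in \<open>auto simp: inj_def\<close>)
      also have "\<dots> \<le> ennreal (r ^ t)"
        using c r by (simp add: ennreal_power mult_left_le power_le_one flip: ennreal_mult)
      finally show ?thesis using r by (simp add: emeasure_eq_measure)
    qed
    have "summable (\<lambda>t. r ^ t)" using r by (intro summable_geometric) auto
    then have "summable (\<lambda>t. prob (?A t))"
      by (rule summable_comparison_test'[where N = 0]) (use le in auto)
    then have "AE \<xi> in moves d. eventually (\<lambda>t. \<xi> \<in> space (moves d) - ?A t) sequentially"
      using meas by (intro borel_cantelli_AE1) (auto simp: less_top[symmetric])
    then show ?thesis
    proof eventually_elim
      case (elim \<xi>)
      then obtain n where "\<And>t. t \<ge> n \<Longrightarrow> walk \<xi> u i t \<noteq> \<rho>"
        by (auto simp: eventually_sequentially)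
      then have "{t. walk \<xi> u i t = \<rho>} \<subseteq> {..<n}" by (auto simp: not_le[symmetric])
      then show ?case by (rule finite_subset) simp
    qed
  qed
  have "AE \<xi> in moves d. \<forall>i. finite {t. walk \<xi> u i t = \<rho>}" if "u \<in> tree_vertices d" for u
    unfolding AE_all_countable using ret[OF that] by blast
  then show ?thesis by (subst AE_ball_countable) auto
qed

lemma AE_moves_label:
  "AE \<xi> in moves d. \<forall>p\<in>tree_vertices d \<times> UNIV \<times> UNIV. \<xi> p \<le> d"
  unfolding moves_def
  by (intro AE_ball_countable[THEN iffD2] ballI AE_PiM_component)
    (auto simp: prob_space_measure_pmf AE_measure_pmf_iff)

section \<open>Clusters and their independence\<close>

text \<open>
  The blocks \<open>K j\<close> may be infinite, as is needed for the moves of the particles of a vertex, of which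
  there are infinitely many at infinitely many times. In the last hypothesis \<open>f j\<close> is extended from
  block \<open>K j\<close> to all configurations, so that no restriction appears in the conclusion.
\<close>
lemma nn_integral_PiM_prod:
  fixes f :: "'j \<Rightarrow> ('i \<Rightarrow> 'a) \<Rightarrow> ennreal"
  assumes M: "\<And>i. i \<in> I \<Longrightarrow> prob_space (M i)" and "finite J"
    and K: "\<And>j. j \<in> J \<Longrightarrow> K j \<subseteq> I" "disjoint_family_on K J"
    and f: "\<And>j. j \<in> J \<Longrightarrow> f j \<in> borel_measurable (PiM (K j) M)"
    and f_restrict: "\<And>j \<omega>. j \<in> J \<Longrightarrow> f j (restrict \<omega> (K j)) = f j \<omega>"
  shows "(\<integral>\<^sup>+ \<omega>. (\<Prod>j\<in>J. f j \<omega>) \<partial>PiM I M) = (\<Prod>j\<in>J. \<integral>\<^sup>+ \<omega>. f j \<omega> \<partial>PiM I M)"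
proof -
  interpret prob_space "PiM I M" by (intro prob_space_PiM M)
  have "indep_vars M (\<lambda>i \<omega>. \<omega> i) I"
  proof (cases "I = {}")
    case False
    have "distr (PiM I M) (PiM I M) (\<lambda>\<omega>. \<lambda>i\<in>I. \<omega> i) = distr (PiM I M) (PiM I M) (\<lambda>\<omega>. \<omega>)"
      by (intro distr_cong) (auto simp: space_PiM)
    also have "\<dots> = (\<Pi>\<^sub>M i\<in>I. distr (PiM I M) (M i) (\<lambda>\<omega>. \<omega> i))"
      by (subst distr_id) (intro PiM_cong refl distr_PiM_component[symmetric] M)
    finally show ?thesis
      using False by (subst indep_vars_iff_distr_eq_PiM') auto
  next
    case True
    show ?thesis unfolding indep_vars_def indep_sets_def using True by auto
  qed
  then have "indep_vars (\<lambda>j. PiM (K j) M) (\<lambda>j \<omega>. restrict (\<lambda>i. \<omega> i) (K j)) J"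
    using K by (rule indep_vars_restrict)
  then have "indep_vars (\<lambda>_. borel) (\<lambda>j \<omega>. f j (restrict \<omega> (K j))) J"
    by (rule indep_vars_compose2) (use f in auto)
  then have "indep_vars (\<lambda>_. borel) f J"
    by (rule indep_vars_cong[THEN iffD1, rotated -1]) (auto simp: f_restrict)
  then show ?thesis
    using \<open>finite J\<close> by (intro indep_vars_nn_integral) auto
qed

lemma walk_restrict:
  "{u} \<times> UNIV \<times> UNIV \<subseteq> K \<Longrightarrow> walk (restrict \<xi> K) u i t = walk \<xi> u i t"
  by (induction t) auto

lemma min_1_le_powr:
  fixes x a :: real
  assumes "0 \<le> x" "0 \<le> a" "a \<le> 1"
  shows "min 1 x \<le> x powr a"
proof (cases "x \<ge> 1")
  case True
  then show ?thesis using assms ge_one_powr_ge_zero[of x a] by simp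
next
  case False
  show ?thesis
  proof (cases "x = 0")
    case False
    then have "x powr 1 \<le> x powr a"
      using assms \<open>\<not> x \<ge> 1\<close> by (intro powr_mono') auto
    then show ?thesis using assms by simp
  qed simp
qed

text \<open>
  The concave bound \<open>min 1 x \<le> x powr (3/4)\<close> is applied to the union bound over the \<open>n\<close> walks. This is
  the step in which the influence of a cluster becomes sublinear in its size. Here \<open>1 / b ^ 3\<close> is
  \<open>d powr (-3/4)\<close>.
\<close>
lemma emeasure_some_hit_le:
  fixes b :: real
  assumes b: "b > 1" "b ^ 4 = real d"
    and u: "u \<in> tree_vertices d" and v: "v \<in> tree_vertices d"
  shows "emeasure (moves d) {\<xi> \<in> space (moves d). \<exists>i<n. \<exists>t. walk \<xi> u i t = v}
    \<le> ennreal (real n powr (3/4)) * ennreal ((1 / b ^ 3) ^ tree_dist u v)"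
proof -
  interpret prob_space "moves d" by (rule prob_space_moves)
  let ?D = "tree_dist u v"
  let ?A = "\<lambda>i. {\<xi> \<in> space (moves d). \<exists>t. walk \<xi> u i t = v}"
  let ?E = "{\<xi> \<in> space (moves d). \<exists>i<n. \<exists>t. walk \<xi> u i t = v}"
  have d: "d \<ge> 1"
    using b one_less_power[of b 4] by (cases d) auto
  have A: "?A i \<in> sets (moves d)" for i using u by measurable
  have "emeasure (moves d) ?E = emeasure (moves d) (\<Union>i<n. ?A i)"
    by (rule arg_cong[where f = "emeasure _"]) auto
  also have "\<dots> \<le> (\<Sum>i<n. emeasure (moves d) (?A i))"
    using A by (intro emeasure_subadditive_finite) auto
  also have "\<dots> \<le> (\<Sum>i<n. ennreal ((1 / real d) ^ ?D))"
    by (intro sum_mono emeasure_hit_le d u v)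
  also have "\<dots> = ennreal (real n * (1 / real d) ^ ?D)"
    by (simp add: ennreal_of_nat_eq_real_of_nat flip: ennreal_mult)
  finally have "prob ?E \<le> real n * (1 / real d) ^ ?D"
    by (simp add: emeasure_eq_measure)
  then have "prob ?E \<le> min 1 (real n * (1 / real d) ^ ?D)" by simp
  also have "\<dots> \<le> (real n * (1 / real d) ^ ?D) powr (3/4)"
    by (intro min_1_le_powr) auto
  also have "\<dots> = real n powr (3/4) * ((1 / real d) ^ ?D) powr (3/4)"
    by (simp add: powr_mult)
  also have "((1 / real d) ^ ?D) powr (3/4) = (1 / b ^ 3) ^ ?D"
  proof -
    have "(1 / real d) ^ ?D = (1 / b) powr real (4 * ?D)"
      using b(1) unfolding b(2)[symmetric] by (subst powr_realpow) (auto simp: power_mult power_divide)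
    then have "((1 / real d) ^ ?D) powr (3/4) = (1 / b) powr real (3 * ?D)"
      by (simp add: powr_powr)
    also have "\<dots> = (1 / b ^ 3) ^ ?D"
      using b(1) by (subst powr_realpow) (auto simp: power_mult power_divide)
    finally show ?thesis .
  qed
  finally have "ennreal (prob ?E) \<le> ennreal (real n powr (3/4) * (1 / b ^ 3) ^ ?D)"
    by (rule ennreal_leI)
  then show ?thesis using b(1) by (simp add: emeasure_eq_measure ennreal_mult)
qed

definition env :: "nat \<Rightarrow> nat pmf \<Rightarrow> (vertex \<Rightarrow> nat) measure" where
  "env d \<pi> = (\<Pi>\<^sub>M v\<in>tree_vertices d. measure_pmf \<pi>)"

lemma prob_space_env: "prob_space (env d \<pi>)"
  unfolding env_def by (intro prob_space_PiM prob_space_measure_pmf)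

lemma frog_model_eq: "frog_model d \<pi> = env d \<pi> \<Otimes>\<^sub>M moves d"
  by (simp add: frog_model_def env_def moves_def)

text \<open>
  Wake-up times are ignored here: the event concerns only the particle number and the walks of \<open>u\<close>, which is
  what makes the events for different \<open>u\<close> independent.
\<close>
definition link :: "realization \<Rightarrow> vertex \<Rightarrow> vertex \<Rightarrow> bool" where
  "link \<omega> u v \<longleftrightarrow> (\<exists>i<initial_particles (fst \<omega>) u. \<exists>t. walk (snd \<omega>) u i t = v)"

lemma measurable_initial_particles:
  "u \<in> I \<Longrightarrow> (\<lambda>\<eta>. initial_particles \<eta> u) \<in> (\<Pi>\<^sub>M v\<in>I. measure_pmf \<pi>) \<rightarrow>\<^sub>M count_space UNIV"
  by (cases "u = \<rho>") (auto simp: initial_particles_def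
      intro: measurable_compose[OF measurable_component_singleton])

lemma measurable_initial_particles_env [measurable]:
  "u \<in> tree_vertices d \<Longrightarrow> (\<lambda>\<eta>. initial_particles \<eta> u) \<in> env d \<pi> \<rightarrow>\<^sub>M count_space UNIV"
  unfolding env_def by (rule measurable_initial_particles)

lemma measurable_link [measurable]:
  assumes [measurable]: "u \<in> tree_vertices d"
  shows "Measurable.pred (frog_model d \<pi>) (\<lambda>\<omega>. link \<omega> u v)"
proof -
  have "(\<lambda>\<omega>. link \<omega> u v) = (\<lambda>\<omega>. \<exists>i. i < initial_particles (fst \<omega>) u \<and> (\<exists>t. walk (snd \<omega>) u i t = v))"
    by (auto simp: link_def)
  then show ?thesis unfolding frog_model_eq by simp measurable
qed

lemma nn_integral_env_powr_le:
  assumes u: "u \<in> tree_vertices d"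
    and \<pi>: "(\<integral>\<^sup>+ n. ennreal (real n powr (3/4)) \<partial>measure_pmf \<pi>) \<le> ennreal \<epsilon>"
  shows "(\<integral>\<^sup>+ \<eta>. ennreal (real (initial_particles \<eta> u) powr (3/4)) \<partial>env d \<pi>)
    \<le> ennreal (if u = \<rho> then 1 else \<epsilon>)"
proof (cases "u = \<rho>")
  case True
  interpret prob_space "env d \<pi>" by (rule prob_space_env)
  show ?thesis using True by (simp add: initial_particles_def emeasure_space_1)
next
  case False
  have "(\<integral>\<^sup>+ \<eta>. ennreal (real (\<eta> u) powr (3/4)) \<partial>env d \<pi>)
      = (\<integral>\<^sup>+ n. ennreal (real n powr (3/4)) \<partial>distr (env d \<pi>) (measure_pmf \<pi>) (\<lambda>\<eta>. \<eta> u))"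
    using u by (subst nn_integral_distr) (auto simp: env_def)
  also have "distr (env d \<pi>) (measure_pmf \<pi>) (\<lambda>\<eta>. \<eta> u) = measure_pmf \<pi>"
    unfolding env_def using u by (intro distr_PiM_component prob_space_measure_pmf)
  finally show ?thesis using False \<pi> by (simp add: initial_particles_def)
qed

text \<open>
  For a fixed environment the events concern the walks of distinct vertices, so that their probability
  is a product. The factors are bounded by functions of the particle numbers of distinct vertices,
  hence the mean over the environment is again a product. The root carries one particle whatever the
  environment is, which is why its factor has \<open>1\<close> in place of \<open>\<epsilon>\<close>.
\<close>
lemma emeasure_links_le:
  fixes b \<epsilon> :: real
  assumes b: "b > 1" "b ^ 4 = real d" and "finite J"
    and x: "inj_on x J" "\<And>j. j \<in> J \<Longrightarrow> x j \<in> tree_vertices d"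
    and w: "\<And>j. j \<in> J \<Longrightarrow> w j \<in> tree_vertices d"
    and \<pi>: "(\<integral>\<^sup>+ n. ennreal (real n powr (3/4)) \<partial>measure_pmf \<pi>) \<le> ennreal \<epsilon>"
  shows "emeasure (frog_model d \<pi>) {\<omega> \<in> space (frog_model d \<pi>). \<forall>j\<in>J. link \<omega> (x j) (w j)}
    \<le> (\<Prod>j\<in>J. ennreal (if x j = \<rho> then 1 else \<epsilon>) * ennreal ((1 / b ^ 3) ^ tree_dist (x j) (w j)))"
proof -
  interpret E: prob_space "env d \<pi>" by (rule prob_space_env)
  interpret X: prob_space "moves d" by (rule prob_space_moves)
  interpret pair_sigma_finite "env d \<pi>" "moves d" by unfold_locales
  let ?E = "{\<omega> \<in> space (frog_model d \<pi>). \<forall>j\<in>J. link \<omega> (x j) (w j)}"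
  let ?H = "\<lambda>n j. {\<xi>. \<exists>i<n. \<exists>t. walk \<xi> (x j) i t = w j}"
  let ?s = "\<lambda>j. ennreal ((1 / b ^ 3) ^ tree_dist (x j) (w j))"
  let ?p = "\<lambda>j \<eta>. ennreal (real (initial_particles \<eta> (x j)) powr (3/4))"
  note [measurable] = x(2)
  have E: "?E \<in> sets (frog_model d \<pi>)"
    using \<open>finite J\<close> by measurable
  have inner: "(\<integral>\<^sup>+ \<xi>. (\<Prod>j\<in>J. indicator (?H (n j) j) \<xi>) \<partial>moves d)
      \<le> (\<Prod>j\<in>J. ennreal (real (n j) powr (3/4)) * ?s j)" for n
  proof -
    have "(\<integral>\<^sup>+ \<xi>. (\<Prod>j\<in>J. indicator (?H (n j) j) \<xi>) \<partial>moves d)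
        = (\<Prod>j\<in>J. \<integral>\<^sup>+ \<xi>. indicator (?H (n j) j) \<xi> \<partial>moves d)"
      unfolding moves_def
    proof (rule nn_integral_PiM_prod[where K = "\<lambda>j. {x j} \<times> UNIV \<times> UNIV"])
      show "disjoint_family_on (\<lambda>j. {x j} \<times> UNIV \<times> UNIV) J"
        using x(1) by (auto simp: disjoint_family_on_def inj_on_def)
      fix j
      have [measurable]: "(\<lambda>\<xi>. walk \<xi> (x j) i t) \<in>
          (\<Pi>\<^sub>M p\<in>{x j} \<times> UNIV \<times> UNIV. measure_pmf (pmf_of_set {0..d})) \<rightarrow>\<^sub>M count_space UNIV" for i t
        by (rule measurable_walk) auto
      show "indicator (?H (n j) j) \<in> borel_measurable
          (\<Pi>\<^sub>M p\<in>{x j} \<times> UNIV \<times> UNIV. measure_pmf (pmf_of_set {0..d}))"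
        unfolding indicator_def by measurable
    qed (use \<open>finite J\<close> x(2) in \<open>auto simp: prob_space_measure_pmf walk_restrict indicator_def\<close>)
    also have "\<dots> \<le> (\<Prod>j\<in>J. ennreal (real (n j) powr (3/4)) * ?s j)"
    proof (rule prod_mono_ennreal)
      fix j assume j: "j \<in> J"
      have "(\<integral>\<^sup>+ \<xi>. indicator (?H (n j) j) \<xi> \<partial>moves d)
          = (\<integral>\<^sup>+ \<xi>. indicator {\<xi> \<in> space (moves d). \<exists>i<n j. \<exists>t. walk \<xi> (x j) i t = w j} \<xi> \<partial>moves d)"
        by (intro nn_integral_cong) (auto simp: indicator_def)
      also have "\<dots> = emeasure (moves d) {\<xi> \<in> space (moves d). \<exists>i<n j. \<exists>t. walk \<xi> (x j) i t = w j}"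
        by (rule nn_integral_indicator) (use x(2)[OF j] in measurable)
      also have "\<dots> \<le> ennreal (real (n j) powr (3/4)) * ?s j"
        by (rule emeasure_some_hit_le[OF b x(2)[OF j] w[OF j]])
      finally show "(\<integral>\<^sup>+ \<xi>. indicator (?H (n j) j) \<xi> \<partial>moves d)
          \<le> ennreal (real (n j) powr (3/4)) * ?s j" .
    qed
    finally show ?thesis .
  qed
  have "emeasure (frog_model d \<pi>) ?E = (\<integral>\<^sup>+ \<omega>. indicator ?E \<omega> \<partial>frog_model d \<pi>)"
    using E by simp
  also have "\<dots> = (\<integral>\<^sup>+ \<eta>. \<integral>\<^sup>+ \<xi>. indicator ?E (\<eta>, \<xi>) \<partial>moves d \<partial>env d \<pi>)"
    using E unfolding frog_model_eq by (subst X.nn_integral_fst) auto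
  also have "\<dots> = (\<integral>\<^sup>+ \<eta>. \<integral>\<^sup>+ \<xi>. (\<Prod>j\<in>J. indicator (?H (initial_particles \<eta> (x j)) j) \<xi>) \<partial>moves d \<partial>env d \<pi>)"
  proof (intro nn_integral_cong)
    fix \<eta> \<xi> assume "\<eta> \<in> space (env d \<pi>)" "\<xi> \<in> space (moves d)"
    then show "indicator ?E (\<eta>, \<xi>) = (\<Prod>j\<in>J. indicator (?H (initial_particles \<eta> (x j)) j) \<xi> :: ennreal)"
      using \<open>finite J\<close>
      by (auto simp: indicator_def frog_model_eq space_pair_measure link_def prod_zero_iff split: if_splits)
  qed
  also have "\<dots> \<le> (\<integral>\<^sup>+ \<eta>. (\<Prod>j\<in>J. ?p j \<eta> * ?s j) \<partial>env d \<pi>)"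
    by (intro nn_integral_mono inner)
  also have "\<dots> = (\<Prod>j\<in>J. \<integral>\<^sup>+ \<eta>. ?p j \<eta> * ?s j \<partial>env d \<pi>)"
    unfolding env_def
  proof (rule nn_integral_PiM_prod[where K = "\<lambda>j. {x j}"])
    show "disjoint_family_on (\<lambda>j. {x j}) J"
      using x(1) by (auto simp: disjoint_family_on_def inj_on_def)
    fix j
    have [measurable]: "(\<lambda>\<eta>. initial_particles \<eta> (x j)) \<in>
        (\<Pi>\<^sub>M v\<in>{x j}. measure_pmf \<pi>) \<rightarrow>\<^sub>M count_space UNIV"
      by (rule measurable_initial_particles) simp
    show "(\<lambda>\<eta>. ?p j \<eta> * ?s j) \<in> borel_measurable (\<Pi>\<^sub>M v\<in>{x j}. measure_pmf \<pi>)"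
      by measurable
  qed (use \<open>finite J\<close> x(2) in \<open>auto simp: prob_space_measure_pmf initial_particles_def\<close>)
  also have "\<dots> \<le> (\<Prod>j\<in>J. ennreal (if x j = \<rho> then 1 else \<epsilon>) * ?s j)"
  proof (rule prod_mono_ennreal)
    fix j assume j: "j \<in> J"
    have "(\<integral>\<^sup>+ \<eta>. ?p j \<eta> * ?s j \<partial>env d \<pi>) = (\<integral>\<^sup>+ \<eta>. ?p j \<eta> \<partial>env d \<pi>) * ?s j"
      by (rule nn_integral_multc) (use x(2)[OF j] in measurable)
    also have "\<dots> \<le> ennreal (if x j = \<rho> then 1 else \<epsilon>) * ?s j"
      by (intro mult_right_mono nn_integral_env_powr_le x(2) j \<pi>) auto
    finally show "(\<integral>\<^sup>+ \<eta>. ?p j \<eta> * ?s j \<partial>env d \<pi>) \<le> ennreal (if x j = \<rho> then 1 else \<epsilon>) * ?s j" .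
  qed
  finally show ?thesis .
qed

section \<open>Chains of wake-ups\<close>

text \<open>
  The recursive form of a product over the links of a closed chain, suited to summation over the
  first vertex after \<open>u\<close>.
\<close>
primrec chain_weight :: "(vertex \<Rightarrow> vertex \<Rightarrow> real) \<Rightarrow> vertex \<Rightarrow> vertex list \<Rightarrow> real" where
  "chain_weight k u [] = k u \<rho>"
| "chain_weight k u (v # cs) = k u v * chain_weight k v cs"

lemma chain_weight_eq_prod:
  "chain_weight k u cs = (\<Prod>j\<le>length cs. k ((u # cs) ! j) ((cs @ [\<rho>]) ! j))"
  by (induction cs arbitrary: u) (simp_all add: prod.atMost_Suc_shift del: prod.atMost_Suc)

lemma chain_weight_nonneg: "(\<And>u v. k u v \<ge> 0) \<Longrightarrow> chain_weight k u cs \<ge> 0"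
  by (induction cs arbitrary: u) auto

text \<open>
  The weight \<open>h\<close> is halved by the kernel, so it bounds the chains of length at most \<open>n\<close> by induction on
  \<open>n\<close>: one half of \<open>h u\<close> pays for the empty chain, the other half for the first step and, by the
  induction hypothesis, everything after it. The set \<open>V\<close> is finite to keep all sums finite, while the
  bound does not depend on it.
\<close>
lemma sum_chain_weight_le:
  assumes V: "finite V" and k: "\<And>u v. k u v \<ge> 0"
    and h: "\<And>u. u \<in> insert \<rho> V \<Longrightarrow> (\<Sum>v\<in>V. k u v * h v) \<le> h u / 2"
      "\<And>u. u \<in> insert \<rho> V \<Longrightarrow> k u \<rho> \<le> h u / 2" and u: "u \<in> insert \<rho> V"
  shows "(\<Sum>cs | set cs \<subseteq> V \<and> length cs \<le> n. chain_weight k u cs) \<le> h u"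
  using u
proof (induction n arbitrary: u)
  case 0
  have "{cs. set cs \<subseteq> V \<and> length cs \<le> 0} = {[]}" by auto
  moreover have "0 \<le> h u" using h(2)[OF 0] k[of u \<rho>] by linarith
  ultimately show ?case using h(2)[OF 0] by simp
next
  case (Suc n)
  let ?C = "\<lambda>n. {cs. set cs \<subseteq> V \<and> length cs \<le> n}"
  have fin: "finite (?C n)" for n by (rule finite_lists_length_le[OF V])
  have C_Suc: "?C (Suc n) = insert [] ((\<lambda>(v, cs). v # cs) ` (V \<times> ?C n))"
  proof (intro set_eqI iffI)
    fix cs assume "cs \<in> ?C (Suc n)"
    then show "cs \<in> insert [] ((\<lambda>(v, cs). v # cs) ` (V \<times> ?C n))"
      by (cases cs) auto
  qed auto
  have "(\<Sum>cs\<in>?C (Suc n). chain_weight k u cs)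
      = k u \<rho> + (\<Sum>cs\<in>(\<lambda>(v, cs). v # cs) ` (V \<times> ?C n). chain_weight k u cs)"
    unfolding C_Suc using V fin by (subst sum.insert) auto
  also have "(\<Sum>cs\<in>(\<lambda>(v, cs). v # cs) ` (V \<times> ?C n). chain_weight k u cs)
      = (\<Sum>(v, cs)\<in>V \<times> ?C n. k u v * chain_weight k v cs)"
    by (subst sum.reindex) (auto simp: inj_on_def intro!: sum.cong)
  also have "\<dots> = (\<Sum>v\<in>V. k u v * (\<Sum>cs\<in>?C n. chain_weight k v cs))"
    by (simp add: sum_distrib_left flip: sum.cartesian_product)
  also have "\<dots> \<le> (\<Sum>v\<in>V. k u v * h v)"
    using Suc.IH k by (intro sum_mono mult_left_mono) auto
  finally show ?case using h(1,2)[OF Suc.prems] by simp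
qed

text \<open>
  A chain is given by its vertices after the root. The closing link back to the root, present in open
  chains, is what makes a chain witness a visit; the empty chain stands for a return of the first particle.
\<close>
definition is_chain :: "nat \<Rightarrow> vertex list \<Rightarrow> bool" where
  "is_chain d cs \<longleftrightarrow> distinct (\<rho> # cs) \<and> set cs \<subseteq> tree_vertices d"

definition chain_open :: "realization \<Rightarrow> vertex list \<Rightarrow> bool" where
  "chain_open \<omega> cs \<longleftrightarrow> (\<forall>j\<le>length cs. link \<omega> ((\<rho> # cs) ! j) ((cs @ [\<rho>]) ! j))"

lemma root_in_tree: "\<rho> \<in> tree_vertices d"
  by (simp add: tree_vertices_def)

lemma chain_vertices:
  assumes "is_chain d cs" "j \<le> length cs"
  shows "(\<rho> # cs) ! j \<in> tree_vertices d" "(cs @ [\<rho>]) ! j \<in> tree_vertices d"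
proof -
  have "(\<rho> # cs) ! j \<in> set (\<rho> # cs)" "(cs @ [\<rho>]) ! j \<in> set (cs @ [\<rho>])"
    using assms(2) by (intro nth_mem; simp)+
  then show "(\<rho> # cs) ! j \<in> tree_vertices d" "(cs @ [\<rho>]) ! j \<in> tree_vertices d"
    using assms(1) root_in_tree[of d] by (auto simp: is_chain_def)
qed

lemma measurable_chain_open:
  assumes "is_chain d cs"
  shows "{\<omega> \<in> space (frog_model d \<pi>). chain_open \<omega> cs} \<in> sets (frog_model d \<pi>)"
proof -
  have [measurable]: "(\<rho> # cs) ! j \<in> tree_vertices d" if "j \<in> {..length cs}" for j
    using chain_vertices(1)[OF assms, of j] that by simp
  have "{\<omega> \<in> space (frog_model d \<pi>). chain_open \<omega> cs} =
      {\<omega> \<in> space (frog_model d \<pi>). \<forall>j\<in>{..length cs}. link \<omega> ((\<rho> # cs) ! j) ((cs @ [\<rho>]) ! j)}"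
    by (auto simp: chain_open_def)
  also have "\<dots> \<in> sets (frog_model d \<pi>)" by measurable
  finally show ?thesis .
qed

text \<open>
  The division by \<open>\<epsilon>\<close> makes up for the root, which lacks this factor.
\<close>
lemma measure_chain_open_le:
  fixes b \<epsilon> :: real
  assumes b: "b > 1" "b ^ 4 = real d" and cs: "is_chain d cs" and "\<epsilon> > 0"
    and \<pi>: "(\<integral>\<^sup>+ n. ennreal (real n powr (3/4)) \<partial>measure_pmf \<pi>) \<le> ennreal \<epsilon>"
  shows "measure (frog_model d \<pi>) {\<omega> \<in> space (frog_model d \<pi>). chain_open \<omega> cs}
    \<le> chain_weight (\<lambda>u v. \<epsilon> * (1 / b ^ 3) ^ tree_dist u v) \<rho> cs / \<epsilon>"
proof -
  interpret prob_space "frog_model d \<pi>" by (rule prob_space_frog_model)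
  define x w where "x j = (\<rho> # cs) ! j" and "w j = (cs @ [\<rho>]) ! j" for j
  define s where "s j = (1 / b ^ 3) ^ tree_dist (x j) (w j)" for j
  have s: "s j \<ge> 0" for j using b by (simp add: s_def)
  have x_Suc: "x (Suc j) \<noteq> \<rho>" if "j < length cs" for j
    using cs nth_mem[OF that] by (auto simp: x_def is_chain_def)
  have "emeasure (frog_model d \<pi>) {\<omega> \<in> space (frog_model d \<pi>). chain_open \<omega> cs}
      = emeasure (frog_model d \<pi>) {\<omega> \<in> space (frog_model d \<pi>). \<forall>j\<in>{..length cs}. link \<omega> (x j) (w j)}"
    by (rule arg_cong[where f = "emeasure _"]) (auto simp: chain_open_def x_def w_def)
  also have "\<dots> \<le> (\<Prod>j\<le>length cs. ennreal (if x j = \<rho> then 1 else \<epsilon>) * ennreal (s j))"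
    unfolding s_def
  proof (rule emeasure_links_le[OF b _ _ _ _ \<pi>])
    show "inj_on x {..length cs}"
      using cs by (auto simp: inj_on_def x_def is_chain_def nth_eq_iff_index_eq simp del: distinct.simps)
  qed (use chain_vertices[OF cs] in \<open>auto simp: x_def w_def\<close>)
  also have "\<dots> = ennreal (\<Prod>j\<le>length cs. (if x j = \<rho> then 1 else \<epsilon>) * s j)"
    using \<open>\<epsilon> > 0\<close> s by (subst prod_ennreal[symmetric]) (auto simp: ennreal_mult intro!: prod.cong)
  also have "(\<Prod>j\<le>length cs. (if x j = \<rho> then 1 else \<epsilon>) * s j)
      = s 0 * (\<Prod>j<length cs. \<epsilon> * s (Suc j))"
    using x_Suc by (subst prod.atMost_shift) (auto simp: x_def intro!: prod.cong)
  also have "\<dots> = (\<Prod>j\<le>length cs. \<epsilon> * s j) / \<epsilon>"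
    using \<open>\<epsilon> > 0\<close> by (subst prod.atMost_shift) auto
  also have "(\<Prod>j\<le>length cs. \<epsilon> * s j) = chain_weight (\<lambda>u v. \<epsilon> * (1 / b ^ 3) ^ tree_dist u v) \<rho> cs"
    by (simp add: chain_weight_eq_prod s_def x_def w_def)
  finally show ?thesis
    using b \<open>\<epsilon> > 0\<close> by (simp add: emeasure_eq_measure chain_weight_nonneg)
qed

text \<open>
  The kernel halves the weight since \<open>\<epsilon>\<close> times the constant in \<open>sum_tree_dist_le\<close> is at most
  \<open>1/2\<close>. Then all finite sums of probabilities of open chains are at most \<open>1 / \<epsilon>\<close>, and Borel-Cantelli
  applies to an enumeration of the countably many chains.
\<close>
lemma AE_finite_open_chains:
  fixes b \<epsilon> :: real
  assumes b: "b > 1" "b ^ 4 = real d" and \<epsilon>: "\<epsilon> > 0" "\<epsilon> \<le> (1 - 1 / b)\<^sup>2 / 4"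
    and \<pi>: "(\<integral>\<^sup>+ n. ennreal (real n powr (3/4)) \<partial>measure_pmf \<pi>) \<le> ennreal \<epsilon>"
  shows "AE \<omega> in frog_model d \<pi>. finite {cs. is_chain d cs \<and> chain_open \<omega> cs}"
proof -
  interpret prob_space "frog_model d \<pi>" by (rule prob_space_frog_model)
  define k where "k = (\<lambda>u v. \<epsilon> * (1 / b ^ 3) ^ tree_dist u v)"
  define h where "h u = (1 / b\<^sup>2) ^ length u" for u :: vertex
  have k: "k u v \<ge> 0" for u v using b \<epsilon> by (simp add: k_def)
  have d: "d \<ge> 1" using b one_less_power[of b 4] by (cases d) auto
  have kh: "(\<Sum>v\<in>V. k u v * h v) \<le> h u / 2"
    if "finite V" "V \<subseteq> tree_vertices d" "u \<in> tree_vertices d" for V u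
  proof -
    have "(\<Sum>v\<in>V. k u v * h v) = \<epsilon> * (\<Sum>v\<in>V. (1 / b ^ 3) ^ tree_dist u v * (1 / b\<^sup>2) ^ length v)"
      by (simp add: k_def h_def sum_distrib_left mult.assoc)
    also have "\<dots> \<le> (1 - 1 / b)\<^sup>2 / 4 * (2 / (1 - 1 / b)\<^sup>2 * h u)"
      unfolding h_def using \<epsilon> b that d
      by (intro mult_mono sum_tree_dist_le) (auto intro!: sum_nonneg)
    also have "\<dots> = h u / 2" using b by simp
    finally show ?thesis .
  qed
  define E where "E cs = (if is_chain d cs
    then {\<omega> \<in> space (frog_model d \<pi>). chain_open \<omega> cs} else {})" for cs
  have E: "E cs \<in> sets (frog_model d \<pi>)" for cs
    using measurable_chain_open by (simp add: E_def)
  have sum_E: "(\<Sum>cs\<in>F. prob (E cs)) \<le> 1 / \<epsilon>" if F: "finite F" for F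
  proof -
    define G where "G = {cs \<in> F. is_chain d cs}"
    define V where "V = \<Union> (set ` G)"
    define n where "n = Max (insert 0 (length ` G))"
    have G: "finite G" using F by (simp add: G_def)
    have V: "finite V" "V \<subseteq> tree_vertices d"
      using G by (auto simp: V_def G_def is_chain_def)
    have "(\<Sum>cs\<in>F. prob (E cs)) = (\<Sum>cs\<in>G. prob (E cs))"
      using F by (intro sum.mono_neutral_right) (auto simp: G_def E_def)
    also have "\<dots> \<le> (\<Sum>cs\<in>G. chain_weight k \<rho> cs / \<epsilon>)"
      using measure_chain_open_le[OF b _ \<epsilon>(1) \<pi>]
      by (intro sum_mono) (auto simp: G_def E_def k_def)
    also have "\<dots> = (\<Sum>cs\<in>G. chain_weight k \<rho> cs) / \<epsilon>"
      by (simp add: sum_divide_distrib)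
    also have "\<dots> \<le> (\<Sum>cs | set cs \<subseteq> V \<and> length cs \<le> n. chain_weight k \<rho> cs) / \<epsilon>"
      using G \<epsilon> k V
      by (intro divide_right_mono sum_mono2 finite_lists_length_le chain_weight_nonneg)
        (auto simp: V_def n_def intro!: Max_ge)
    also have "\<dots> \<le> h \<rho> / \<epsilon>"
    proof (intro divide_right_mono sum_chain_weight_le)
      fix u assume "u \<in> insert \<rho> V"
      then have u: "u \<in> tree_vertices d" using V root_in_tree by auto
      show "(\<Sum>v\<in>V. k u v * h v) \<le> h u / 2" by (rule kh[OF V u])
      show "k u \<rho> \<le> h u / 2"
        using kh[of "{\<rho>}", OF _ _ u] root_in_tree by (simp add: h_def)
    qed (use V k \<epsilon> in auto)
    finally show ?thesis by (simp add: h_def)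
  qed
  define e :: "nat \<Rightarrow> vertex list" where "e = from_nat_into UNIV"
  have e: "bij e"
    unfolding e_def by (intro bij_betw_from_nat_into infinite_UNIV_listI) auto
  have "(\<Sum>i<n. prob (E (e i))) \<le> 1 / \<epsilon>" for n
  proof -
    have "inj_on e {..<n}" using e by (auto simp: bij_def intro: inj_on_subset)
    then have "(\<Sum>i<n. prob (E (e i))) = (\<Sum>cs\<in>e ` {..<n}. prob (E cs))"
      by (simp add: sum.reindex)
    then show ?thesis using sum_E[of "e ` {..<n}"] by simp
  qed
  then have "summable (\<lambda>n. prob (E (e n)))"
    by (intro summableI_nonneg_bounded) auto
  then have "AE \<omega> in frog_model d \<pi>. eventually (\<lambda>n. \<omega> \<in> space (frog_model d \<pi>) - E (e n)) sequentially"
    using E by (intro borel_cantelli_AE1) (auto simp: less_top[symmetric])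
  then show ?thesis
    using AE_space
  proof eventually_elim
    case (elim \<omega>)
    then obtain n where n: "\<And>m. m \<ge> n \<Longrightarrow> \<omega> \<notin> E (e m)"
      by (auto simp: eventually_sequentially)
    have "{cs. is_chain d cs \<and> chain_open \<omega> cs} \<subseteq> e ` {..<n}"
    proof
      fix cs assume "cs \<in> {cs. is_chain d cs \<and> chain_open \<omega> cs}"
      then have "\<omega> \<in> E cs" using elim(2) by (simp add: E_def)
      moreover obtain m where "cs = e m" using e by (auto simp: bij_def surj_def)
      ultimately show "cs \<in> e ` {..<n}" using n[of m] by (cases "m < n") auto
    qed
    then show ?case by (rule finite_subset) simp
  qed
qed

section \<open>From the frog model to chains\<close>

text \<open>
  Loops are cut as the chain grows: when the new end point already occurs, the chain is truncated there.
\<close>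
lemma ex_distinct_chain:
  assumes "R\<^sup>*\<^sup>* x y"
  shows "\<exists>cs. distinct (x # cs) \<and> successively R (x # cs) \<and> last (x # cs) = y"
  using assms
proof (induction rule: rtranclp_induct)
  case base
  show ?case by (intro exI[of _ "[]"]) auto
next
  case (step y z)
  then obtain cs where cs: "distinct (x # cs)" "successively R (x # cs)" "last (x # cs) = y" by blast
  show ?case
  proof (cases "z \<in> set (x # cs)")
    case True
    then obtain p q where pq: "x # cs = p @ z # q" by (meson split_list)
    then have pz: "x # cs = (p @ [z]) @ q" by simp
    obtain cs' where cs': "p @ [z] = x # cs'" using pq by (cases p) auto
    have "distinct (p @ [z])" using cs(1) unfolding pz by simp
    moreover have "successively R (p @ [z])"
      using cs(2) unfolding pz by (simp add: successively_append_iff)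
    moreover have "last (p @ [z]) = z" by simp
    ultimately show ?thesis unfolding cs' by blast
  next
    case False
    have "successively R ((x # cs) @ [z])"
      unfolding successively_append_iff using cs step by simp
    then show ?thesis using False cs by (intro exI[of _ "cs @ [z]"]) auto
  qed
qed

lemma walk_in_tree:
  assumes "u \<in> tree_vertices d" "\<And>t. \<xi> (u, i, t) \<le> d"
  shows "walk \<xi> u i t \<in> tree_vertices d"
proof (induction t)
  case (Suc t)
  let ?x = "walk \<xi> u i t"
  have "distinct_adj (step ?x (\<xi> (u, i, t)))"
    using Suc by (intro distinct_adj_step) (simp add: tree_vertices_def)
  moreover have "set (step ?x (\<xi> (u, i, t))) \<subseteq> {0..d}"
    using Suc assms(2)[of t] by (cases ?x) (auto simp: step_def tree_vertices_def)
  ultimately show ?case by (simp add: tree_vertices_def)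
qed (use assms in simp)

lemma wake_mono:
  assumes "wake \<omega> n v = Some s" "n \<le> n'"
  shows "wake \<omega> n' v = Some s"
  using assms(2)
proof (induction n')
  case (Suc n')
  show ?case
  proof (cases "n = Suc n'")
    case False
    with Suc have "wake \<omega> n' v = Some s" by simp
    then show ?thesis by simp
  qed (use assms(1) in simp)
qed (use assms(1) in simp)

lemma wake_unique:
  assumes "wake \<omega> n v = Some s" "wake \<omega> n' v = Some s'"
  shows "s = s'"
  using wake_mono[OF assms(1), of "max n n'"] wake_mono[OF assms(2), of "max n n'"] by simp

lemma wake_le: "wake \<omega> n v = Some s \<Longrightarrow> s \<le> n"
  by (induction n arbitrary: v s) (auto split: if_splits option.splits intro: le_SucI)

lemma wake_reachable:
  assumes "\<And>p. p \<in> tree_vertices d \<times> UNIV \<times> UNIV \<Longrightarrow> snd \<omega> p \<le> d"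
  shows "wake \<omega> n v = Some s \<Longrightarrow>
    v \<in> tree_vertices d \<and> (\<lambda>u v. link \<omega> u v \<and> v \<in> tree_vertices d)\<^sup>*\<^sup>* \<rho> v"
proof (induction n arbitrary: v s)
  case 0
  then show ?case using root_in_tree by (auto split: if_splits)
next
  case (Suc n)
  show ?case
  proof (cases "wake \<omega> n v")
    case None
    then obtain u i s' where u: "wake \<omega> n u = Some s'" "i < initial_particles (fst \<omega>) u"
        "walk (snd \<omega>) u i (Suc n - s') = v"
      using Suc.prems by (auto split: if_splits)
    have IH: "u \<in> tree_vertices d" "(\<lambda>u v. link \<omega> u v \<and> v \<in> tree_vertices d)\<^sup>*\<^sup>* \<rho> u"
      using Suc.IH[OF u(1)] by auto
    have "v \<in> tree_vertices d" using walk_in_tree[OF IH(1), of "snd \<omega>" i] assms IH(1) u(3) by auto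
    moreover have "link \<omega> u v" using u by (auto simp: link_def)
    ultimately show ?thesis using IH(2) by (auto intro: rtranclp.rtrancl_into_rtrancl)
  next
    case (Some s')
    then show ?thesis using Suc.IH by blast
  qed
qed

text \<open>
  A visit to the root by a particle of \<open>u\<close> makes a loop-free chain leading to \<open>u\<close> open, so \<open>u\<close> is the
  last vertex of one of finitely many chains. At \<open>u\<close> there are finitely many particles, each of
  which returns finitely often and whose clock is shifted by the wake-up time of \<open>u\<close>.
\<close>
lemma transient_if_finite:
  assumes labels: "\<And>p. p \<in> tree_vertices d \<times> UNIV \<times> UNIV \<Longrightarrow> snd \<omega> p \<le> d"
    and walks: "\<And>u i. u \<in> tree_vertices d \<Longrightarrow> finite {t. walk (snd \<omega>) u i t = \<rho>}"
    and chains: "finite {cs. is_chain d cs \<and> chain_open \<omega> cs}"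
  shows "transient \<omega>"
proof -
  let ?C = "{cs. is_chain d cs \<and> chain_open \<omega> cs}"
  define U where "U = (\<lambda>cs. last (\<rho> # cs)) ` ?C"
  define \<sigma> where "\<sigma> u = (SOME s. \<exists>n. wake \<omega> n u = Some s)" for u
  let ?B = "\<Union>u\<in>U \<inter> tree_vertices d. \<Union>i<initial_particles (fst \<omega>) u.
    (\<lambda>t. (u, i, \<sigma> u + t)) ` {t. walk (snd \<omega>) u i t = \<rho>}"
  have "root_visits \<omega> \<subseteq> ?B"
  proof
    fix p assume "p \<in> root_visits \<omega>"
    then obtain u i n s where p: "p = (u, i, n)" and s: "wake \<omega> n u = Some s"
        and i: "i < initial_particles (fst \<omega>) u" and visit: "walk (snd \<omega>) u i (n - s) = \<rho>"
      by (auto simp: root_visits_def active_at_def)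
    have "\<exists>n. wake \<omega> n u = Some (\<sigma> u)"
      unfolding \<sigma>_def by (rule someI_ex) (use s in blast)
    then have \<sigma>: "\<sigma> u = s" using wake_unique[OF s] by blast
    have u: "u \<in> tree_vertices d" "(\<lambda>u v. link \<omega> u v \<and> v \<in> tree_vertices d)\<^sup>*\<^sup>* \<rho> u"
      using wake_reachable[OF labels s] by auto
    then obtain cs where cs: "distinct (\<rho> # cs)" "last (\<rho> # cs) = u"
        "successively (\<lambda>u v. link \<omega> u v \<and> v \<in> tree_vertices d) (\<rho> # cs)"
      using ex_distinct_chain[OF u(2)] by blast
    have "link \<omega> u \<rho>" using i visit by (auto simp: link_def)
    then have succ: "successively (\<lambda>u v. link \<omega> u v \<and> v \<in> tree_vertices d) ((\<rho> # cs) @ [\<rho>])"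
      unfolding successively_append_iff using cs root_in_tree by simp
    have link: "link \<omega> ((\<rho> # cs) ! j) ((cs @ [\<rho>]) ! j) \<and> (cs @ [\<rho>]) ! j \<in> tree_vertices d"
      if "j \<le> length cs" for j
    proof -
      have "((\<rho> # cs) @ [\<rho>]) ! j = (\<rho> # cs) ! j" "((\<rho> # cs) @ [\<rho>]) ! Suc j = (cs @ [\<rho>]) ! j"
        using that by (subst nth_append; simp)+
      then show ?thesis
        using succ that unfolding successively_conv_nth by (metis Suc_le_mono Suc_le_eq
            length_append_singleton length_Cons less_Suc_eq_le)
    qed
    have "set cs \<subseteq> tree_vertices d"
    proof
      fix v assume "v \<in> set cs"
      then obtain j where "j < length cs" "v = cs ! j" by (auto simp: in_set_conv_nth)
      then show "v \<in> tree_vertices d" using link[of j] by (simp add: nth_append)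
    qed
    then have "cs \<in> ?C" using cs(1) link by (simp add: is_chain_def chain_open_def)
    then have "u \<in> U" using cs(2) by (auto simp: U_def)
    moreover have "n = \<sigma> u + (n - s)" using \<sigma> wake_le[OF s] by simp
    ultimately show "p \<in> ?B" using p u(1) i visit by blast
  qed
  moreover have "finite ?B"
    using chains walks by (auto simp: U_def)
  ultimately show ?thesis
    by (auto simp: transient_def recurrent_def intro: finite_subset)
qed

section \<open>The initial distribution and transience\<close>

text \<open>
  For \<open>J\<close> geometric, \<open>2 ^ J\<close> has mean \<open>\<Sum>j. 1/2\<close>, whereas its moment of order \<open>3/4\<close> is a geometric
  series with ratio \<open>q = 2 powr (-1/4)\<close>. Mixing with the point mass at \<open>0\<close> multiplies both by \<open>\<delta>\<close>.
\<close>
lemma ex_heavy_tailed_pmf: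
  fixes \<epsilon> :: real
  assumes "\<epsilon> > 0"
  shows "\<exists>\<pi> :: nat pmf. (\<integral>\<^sup>+ n. of_nat n \<partial>measure_pmf \<pi>) = \<infinity> \<and>
    (\<integral>\<^sup>+ n. ennreal (real n powr (3/4)) \<partial>measure_pmf \<pi>) \<le> ennreal \<epsilon>"
proof -
  let ?G = "map_pmf (\<lambda>j. 2 ^ j) (geometric_pmf (1/2)) :: nat pmf"
  define q :: real where "q = 2 powr (-1/4)"
  define c where "c = 1 / 2 * (1 / (1 - q))"
  have q: "0 < q" "q < 1" by (auto simp: q_def powr_less_one)
  have c: "c > 0" using q by (simp add: c_def)
  define \<delta> where "\<delta> = min 1 (\<epsilon> / c)"
  have \<delta>: "0 < \<delta>" "\<delta> \<le> 1" "\<delta> * c \<le> \<epsilon>"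
    using assms c by (auto simp: \<delta>_def min_def field_simps)
  have mean: "(\<integral>\<^sup>+ n. of_nat n \<partial>measure_pmf ?G) = \<infinity>"
  proof -
    have "(\<integral>\<^sup>+ n. of_nat n \<partial>measure_pmf ?G)
        = (\<integral>\<^sup>+ j. ennreal ((1/2) ^ j * (1/2)) * of_nat (2 ^ j) \<partial>count_space UNIV)"
      unfolding nn_integral_map_pmf by (subst nn_integral_measure_pmf) simp
    also have "\<dots> = (\<integral>\<^sup>+ j. ennreal (1/2) \<partial>count_space (UNIV :: nat set))"
    proof (intro nn_integral_cong)
      fix j :: nat
      have "(of_nat (2 ^ j) :: ennreal) = ennreal (2 ^ j)"
        by (simp add: ennreal_of_nat_eq_real_of_nat)
      then show "ennreal ((1/2) ^ j * (1/2)) * of_nat (2 ^ j) = ennreal (1/2)"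
        by (simp add: power_divide flip: ennreal_mult)
    qed
    also have "\<dots> = \<infinity>"
      by (simp add: ennreal_mult_eq_top_iff)
    finally show ?thesis .
  qed
  have moment: "(\<integral>\<^sup>+ n. ennreal (real n powr (3/4)) \<partial>measure_pmf ?G) = ennreal c"
  proof -
    have "(\<integral>\<^sup>+ n. ennreal (real n powr (3/4)) \<partial>measure_pmf ?G)
        = (\<integral>\<^sup>+ j. ennreal ((1/2) ^ j * (1/2)) * ennreal ((2 ^ j) powr (3/4)) \<partial>count_space UNIV)"
      unfolding nn_integral_map_pmf by (subst nn_integral_measure_pmf) simp
    also have "\<dots> = (\<integral>\<^sup>+ j. ennreal (1 / 2 * q ^ j) \<partial>count_space UNIV)"
    proof (intro nn_integral_cong)
      fix j :: nat
      have "(1/2) ^ j = (2 :: real) powr (- real j)"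
        by (simp add: powr_minus powr_realpow power_one_over inverse_eq_divide)
      moreover have "(2 ^ j) powr (3/4) = (2 :: real) powr (real j * (3/4))"
        by (subst powr_realpow[symmetric]) (simp, rule powr_powr)
      ultimately have "(1/2) ^ j * (2 ^ j) powr (3/4) = (2 :: real) powr (- real j) * 2 powr (real j * (3/4))"
        by (simp only:)
      also have "\<dots> = 2 powr (- real j / 4)"
        by (simp flip: powr_add)
      also have "\<dots> = q ^ j"
        unfolding q_def by (subst powr_realpow[symmetric]) (auto simp: powr_powr)
      finally have "(1/2) ^ j * (1/2) * (2 ^ j) powr (3/4) = 1 / 2 * q ^ j" by simp
      then show "ennreal ((1/2) ^ j * (1/2)) * ennreal ((2 ^ j) powr (3/4)) = ennreal (1 / 2 * q ^ j)"
        by (subst ennreal_mult[symmetric]) simp_all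
    qed
    also have "\<dots> = (\<Sum>j. ennreal (1 / 2 * q ^ j))"
      by (rule nn_integral_count_space_nat)
    also have "\<dots> = ennreal c"
    proof (rule suminf_ennreal_eq)
      show "(\<lambda>j. 1 / 2 * q ^ j) sums c"
        unfolding c_def using q by (intro sums_mult geometric_sums) auto
    qed (use q in auto)
    finally show ?thesis .
  qed
  let ?\<pi> = "bernoulli_pmf \<delta> \<bind> (\<lambda>B. if B then ?G else return_pmf 0)"
  have split: "(\<integral>\<^sup>+ n. f n \<partial>measure_pmf ?\<pi>) = ennreal \<delta> * (\<integral>\<^sup>+ n. f n \<partial>measure_pmf ?G)"
    if "f 0 = 0" for f :: "nat \<Rightarrow> ennreal"
    unfolding nn_integral_bind_pmf
    by (subst nn_integral_bernoulli_pmf) (use \<delta> that in \<open>auto simp: mult.commute\<close>)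
  show ?thesis
  proof (intro exI[of _ ?\<pi>] conjI)
    show "(\<integral>\<^sup>+ n. of_nat n \<partial>measure_pmf ?\<pi>) = \<infinity>"
      by (subst split) (use \<delta> in \<open>simp_all only: mean, auto simp: ennreal_mult_eq_top_iff\<close>)
    show "(\<integral>\<^sup>+ n. ennreal (real n powr (3/4)) \<partial>measure_pmf ?\<pi>) \<le> ennreal \<epsilon>"
      by (subst split) (use \<delta> c in \<open>simp_all only: moment, auto simp flip: ennreal_mult intro: ennreal_leI\<close>)
  qed
qed

lemma AE_moves_imp_AE_frog_model:
  assumes "AE \<xi> in moves d. P \<xi>"
  shows "AE \<omega> in frog_model d \<pi>. P (snd \<omega>)"
proof -
  interpret X: prob_space "moves d" by (rule prob_space_moves)
  obtain N where N: "{\<xi> \<in> space (moves d). \<not> P \<xi>} \<subseteq> N" "emeasure (moves d) N = 0" "N \<in> sets (moves d)"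
    using AE_E[OF assms] by blast
  have "emeasure (frog_model d \<pi>) (space (env d \<pi>) \<times> N) = 0"
    unfolding frog_model_eq using N by (subst X.emeasure_pair_measure_Times) auto
  then have "space (env d \<pi>) \<times> N \<in> null_sets (frog_model d \<pi>)"
    using N by (auto simp: null_sets_def frog_model_eq)
  then show ?thesis
    by (rule AE_I') (use N in \<open>auto simp: frog_model_eq space_pair_measure\<close>)
qed

theorem mainTheorem2:
  fixes d :: nat
  assumes "d \<ge> 2"
  shows "\<exists>\<pi> :: nat pmf.
           (\<integral>\<^sup>+ n. of_nat n \<partial>measure_pmf \<pi>) = \<infinity> \<and>
           (AE \<omega> in frog_model d \<pi>. transient \<omega>)"
proof -
  define b where "b = real d powr (1/4)"
  have b: "b > 1" "b ^ 4 = real d"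
    using assms by (auto simp: b_def powr_powr simp flip: powr_realpow intro: gr_one_powr)
  define \<epsilon> where "\<epsilon> = (1 - 1 / b)\<^sup>2 / 4"
  have \<epsilon>: "\<epsilon> > 0" using b by (simp add: \<epsilon>_def)
  then obtain \<pi> :: "nat pmf" where mean: "(\<integral>\<^sup>+ n. of_nat n \<partial>measure_pmf \<pi>) = \<infinity>"
      and \<pi>: "(\<integral>\<^sup>+ n. ennreal (real n powr (3/4)) \<partial>measure_pmf \<pi>) \<le> ennreal \<epsilon>"
    using ex_heavy_tailed_pmf by blast
  have "AE \<omega> in frog_model d \<pi>. transient \<omega>"
    using AE_moves_imp_AE_frog_model[OF AE_moves_label]
      AE_moves_imp_AE_frog_model[OF AE_finite_root_visits[OF assms]]
      AE_finite_open_chains[OF b \<epsilon> _ \<pi>, unfolded \<epsilon>_def, OF order_refl]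
  proof eventually_elim
    case (elim \<omega>)
    then show ?case by (intro transient_if_finite) auto
  qed
  with mean show ?thesis by blast
qed

end
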